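(* Let $A\in\mathbb{R}^{n\times n}$ be skew-symmetric and $B\in\mathbb{R}^{n\times n}$ symmetric positive definite, and assume that the nonzero eigenvalues $\pm\mathrm{i}\sigma_1,\dots,\pm\mathrm{i}\sigma_\ell$ of $(A,B)$ are simple, with $\sigma_1>\dots>\sigma_\ell>0$. Let $m<\ell$ and let the $m$-step GSSLBD process, started with $q_1\in\mathbb{R}^n$, $\|q_1\|_B=1$, not break down; let $\mathcal{U}_m,\mathcal{V}_m$ be the resulting subspaces and $(\theta_i,\tilde u_i,\tilde v_i)$, $i=1,\dots,m$, the resulting generalized Ritz approximations. For $1\le j\le\ell$, let $(\theta_{j'},\tilde u_{j'},\tilde v_{j'})$ be a generalized Ritz approximation to the generalized spectral triplet $(\sigma_j,u_j,v_j)$ of $(A,B)$ with $\theta_{j'}$ closest to $\sigma_j$ among all the Ritz values $\theta_1,\dots,\theta_m$. Denote $\widetilde{\mathcal{X}}_{j'}=\mathrm{span}\{\tilde u_{j'},\tilde v_{j'}\}$ and $\mathcal{X}_j=\mathrm{span}\{u_j,v_j\}$. Then $$\|\sin\angle_B(\widetilde{\mathcal{X}}_{j'},\mathcal{X}_j)\|_{F}\le\sqrt{1+\frac{\|\mathcal{P}_mH(I-\mathcal{P}_m)\|^2}{\min_{i\ne j'}|\sigma_j-\theta_i|^2}}\ \|\sin\angle_B(\mathcal{U}_m\oplus_B\mathcal{V}_m,\mathcal{X}_j)\|_{F},$$ where $M=B^{1/2}$, $H=M^{-1}AM^{-1}$, $\|\cdot\|$ is the matrix $2$-norm, and $\mathcal{P}_m$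 is the orthogonal projector onto $\mathcal{W}_m\oplus\mathcal{Z}_m$ with $\mathcal{W}_m=M\mathcal{U}_m$ and $\mathcal{Z}_m=M\mathcal{V}_m$.
   Context: Norms: $\|x\|_B=\sqrt{x^{T}Bx}$ for real $x$; $M=B^{1/2}$ is the symmetric positive definite square root of $B$. $\mathcal{K}_m(C,b)=\mathrm{span}\{b,Cb,\dots,C^{m-1}b\}$. Spectral data: the nonzero eigenvalues of $(A,B)$ (i.e. $\lambda$ with $Ax=\lambda Bx$, $x\ne0$) are $\pm\mathrm{i}\sigma_j$, $j=1,\dots,\ell$, where $2\ell=\mathrm{rank}(A)$, with eigenvectors $\frac{1}{\sqrt2}(u_j\pm\mathrm{i}v_j)$, where $u_j,v_j\in\mathbb{R}^n$ satisfy $Av_j=\sigma_jBu_j$, $Au_j=-\sigma_jBv_j$, and $u_1,\dots,u_\ell,v_1,\dots,v_\ell$ are $B$-orthonormal. $(\sigma_j,u_j,v_j)$ is called a generalized spectral triplet of $(A,B)$. $m$-step GSSLBD process: set $\beta_0=0$, $p_0=0$; for $j=1,\dots,m$: $s_j=B^{-1}Aq_j-\beta_{j-1}p_{j-1}$, $\alpha_j=\|s_j\|_B$, $p_j=s_j/\alpha_j$; $t_j=-B^{-1}Ap_j-\alpha_jq_j$, $\beta_j=\|t_j\|_B$, $q_{j+1}=t_j/\beta_j$. It breaks down if some $\alpha_j=0$ or $\beta_j=0$. When it does not break down, $P_m=[p_1,\dots,p_m]$ and $Q_m=[q_1,\dots,q_m]$ have $B$-orthonormal columns forming bases of $\mathcal{U}_m=\mathcal{K}_m((B^{-1}A)^2,p_1)$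 and $\mathcal{V}_m=\mathcal{K}_m((B^{-1}A)^2,q_1)$, and $P_m^{T}BQ_m=0$; $\mathcal{U}_m\oplus_B\mathcal{V}_m$ denotes the direct sum of these $B$-orthogonal subspaces. Ritz approximations: let $G_m\in\mathbb{R}^{m\times m}$ be the upper bidiagonal matrix with diagonal $\alpha_1,\dots,\alpha_m$ and superdiagonal $\beta_1,\dots,\beta_{m-1}$, and let $(\theta_i,c_i,d_i)$, $i=1,\dots,m$, be its singular triplets: $G_md_i=\theta_ic_i$, $G_m^{T}c_i=\theta_id_i$, $\|c_i\|=\|d_i\|=1$, $\theta_1>\theta_2>\dots>\theta_m$. The generalized Ritz approximations are $(\theta_i,\tilde u_i,\tilde v_i)$ with $\tilde u_i=P_mc_i$, $\tilde v_i=Q_md_i$; the $\theta_i$ are the Ritz values. Angles: for subspaces $\mathcal{W},\mathcal{Z}\subseteq\mathbb{R}^n$, $\angle_B(\mathcal{W},\mathcal{Z})=\angle(M\mathcal{W},M\mathcal{Z})$, where $\angle(\cdot,\cdot)$ denotes the usual (Euclidean) canonical angles. $\|\sin\angle_B(\mathcal{W},\mathcal{Z})\|_F=\|\widetilde W_{\perp_B}^{T}B\widetilde Z\|_F$ (Frobenius norm), where $\widetilde W,\widetilde Z$ are matrices whose columns form $B$-orthonormal bases of $\mathcal{W},\mathcal{Z}$ and $\widetilde W_{\perp_B}$ is such that $[\widetilde W,\widetilde W_{\perp_B}]$ is square and $[\widetilde W,\widetilde W_{\perp_B}]^{T}B[\widetilde W,\widetilde W_{\perp_B}]=I$. *)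

theory Defs
  imports "HOL-Analysis.Analysis" "HOL-Computational_Algebra.Polynomial"
begin

subsection \<open>Matrices and the inner product induced by \<open>B\<close>\<close>

definition skew_symmetric :: "real^'n^'n \<Rightarrow> bool" where
  "skew_symmetric A \<longleftrightarrow> transpose A = - A"

definition spd :: "real^'n^'n \<Rightarrow> bool" where
  "spd B \<longleftrightarrow> transpose B = B \<and> (\<forall>x. x \<noteq> 0 \<longrightarrow> 0 < x \<bullet> (B *v x))"

definition spd_sqrt :: "real^'n^'n \<Rightarrow> real^'n^'n \<Rightarrow> bool" where
  "spd_sqrt M B \<longleftrightarrow> spd M \<and> M ** M = B"

definition b_inner :: "real^'n^'n \<Rightarrow> real^'n \<Rightarrow> real^'n \<Rightarrow> real" where
  "b_inner B x y = x \<bullet> (B *v y)"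

definition b_norm :: "real^'n^'n \<Rightarrow> real^'n \<Rightarrow> real" where
  "b_norm B x = sqrt (b_inner B x x)"

definition b_orthonormal :: "real^'n^'n \<Rightarrow> (real^'n) set \<Rightarrow> bool" where
  "b_orthonormal B S \<longleftrightarrow> (\<forall>x\<in>S. \<forall>y\<in>S. b_inner B x y = (if x = y then 1 else 0))"

definition norm2 :: "real^'n^'n \<Rightarrow> real" where
  "norm2 C = onorm ((*v) C)"

definition orthogonal_projector :: "real^'n^'n \<Rightarrow> (real^'n) set \<Rightarrow> bool" where
  "orthogonal_projector P S \<longleftrightarrow> P ** P = P \<and> transpose P = P \<and> range ((*v) P) = S"

definition subspace_sum :: "(real^'n) set \<Rightarrow> (real^'n) set \<Rightarrow> (real^'n) set" where
  "subspace_sum U V = {x + y | x y. x \<in> U \<and> y \<in> V}"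

text \<open>The power of \<open>C\<close> is taken as iterated application, since \<open>^\<close> on vector types is
  componentwise.\<close>

definition krylov :: "nat \<Rightarrow> real^'n^'n \<Rightarrow> real^'n \<Rightarrow> (real^'n) set" where
  "krylov m C b = span ((\<lambda>k. (((*v) C) ^^ k) b) ` {..<m})"


subsection \<open>Eigenvalues and spectral triplets of the pair \<open>(A, B)\<close>\<close>

definition pencil_eigenvalue :: "real^'n^'n \<Rightarrow> real^'n^'n \<Rightarrow> complex \<Rightarrow> bool" where
  "pencil_eigenvalue A B \<mu> \<longleftrightarrow>
     (\<exists>x. x \<noteq> 0 \<and>
        map_matrix complex_of_real A *v x = \<mu> *s (map_matrix complex_of_real B *v x))"

text \<open>The polynomial \<open>det (A - \<lambda> B)\<close> in \<open>\<lambda>\<close>; an eigenvalue is simple if it is a simple root.\<close>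

definition pencil_charpoly :: "real^'n^'n \<Rightarrow> real^'n^'n \<Rightarrow> complex poly" where
  "pencil_charpoly A B =
     det (\<chi> i j. [: complex_of_real (A $ i $ j), - complex_of_real (B $ i $ j) :])"

definition simple_pencil_eigenvalue :: "real^'n^'n \<Rightarrow> real^'n^'n \<Rightarrow> complex \<Rightarrow> bool" where
  "simple_pencil_eigenvalue A B \<mu> \<longleftrightarrow>
     pencil_eigenvalue A B \<mu> \<and> order \<mu> (pencil_charpoly A B) = 1"

definition generalized_spectral_triplet ::
  "real^'n^'n \<Rightarrow> real^'n^'n \<Rightarrow> real \<Rightarrow> real^'n \<Rightarrow> real^'n \<Rightarrow> bool" where
  "generalized_spectral_triplet A B \<sigma> u v \<longleftrightarrow>
     A *v v = \<sigma> *\<^sub>R (B *v u) \<and> A *v u = - (\<sigma> *\<^sub>R (B *v v))"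

text \<open>\<open>u\<^sub>1, \<dots>, u\<^sub>\<ell>, v\<^sub>1, \<dots>, v\<^sub>\<ell>\<close> are \<open>B\<close>-orthonormal as an indexed family.\<close>

definition b_orthonormal_families ::
  "real^'n^'n \<Rightarrow> nat \<Rightarrow> (nat \<Rightarrow> real^'n) \<Rightarrow> (nat \<Rightarrow> real^'n) \<Rightarrow> bool" where
  "b_orthonormal_families B l u v \<longleftrightarrow>
     (\<forall>i\<in>{1..l}. \<forall>j\<in>{1..l}.
        b_inner B (u i) (u j) = (if i = j then 1 else 0) \<and>
        b_inner B (v i) (v j) = (if i = j then 1 else 0) \<and>
        b_inner B (u i) (v j) = 0)"


subsection \<open>The GSSLBD process and the generalized Ritz approximations\<close>

text \<open>The recurrences determine all the quantities from \<open>q 1\<close>, up to the first breakdown.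
  At a breakdown the divisions are by zero.\<close>

definition gsslbd_process ::
  "real^'n^'n \<Rightarrow> real^'n^'n \<Rightarrow> nat \<Rightarrow> (nat \<Rightarrow> real) \<Rightarrow> (nat \<Rightarrow> real) \<Rightarrow>
   (nat \<Rightarrow> real^'n) \<Rightarrow> (nat \<Rightarrow> real^'n) \<Rightarrow> bool" where
  "gsslbd_process A B m \<alpha> \<beta> p q \<longleftrightarrow>
     \<beta> 0 = 0 \<and> p 0 = 0 \<and>
     (\<forall>j\<in>{1..m}.
        let s = matrix_inv B *v (A *v q j) - \<beta> (j - 1) *\<^sub>R p (j - 1);
            t = - (matrix_inv B *v (A *v p j)) - \<alpha> j *\<^sub>R q j
        in \<alpha> j = b_norm B s \<and> p j = s /\<^sub>R \<alpha> j \<and>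
           \<beta> j = b_norm B t \<and> q (j + 1) = t /\<^sub>R \<beta> j)"

definition no_breakdown :: "nat \<Rightarrow> (nat \<Rightarrow> real) \<Rightarrow> (nat \<Rightarrow> real) \<Rightarrow> bool" where
  "no_breakdown m \<alpha> \<beta> \<longleftrightarrow> (\<forall>j\<in>{1..m}. \<alpha> j \<noteq> 0 \<and> \<beta> j \<noteq> 0)"

definition krylov_space ::
  "real^'n^'n \<Rightarrow> real^'n^'n \<Rightarrow> nat \<Rightarrow> real^'n \<Rightarrow> (real^'n) set" where
  "krylov_space A B m b =
     krylov m ((matrix_inv B ** A) ** (matrix_inv B ** A)) b"

text \<open>As \<open>m\<close> varies, \<open>m \<times> m\<close> matrices and \<open>m\<close>-vectors are functions that are only looked at for
  indices in \<open>{1..m}\<close>.\<close>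

definition bidiag :: "(nat \<Rightarrow> real) \<Rightarrow> (nat \<Rightarrow> real) \<Rightarrow> nat \<Rightarrow> nat \<Rightarrow> real" where
  "bidiag \<alpha> \<beta> r k = (if k = r then \<alpha> r else if k = r + 1 then \<beta> r else 0)"

definition singular_triplet ::
  "nat \<Rightarrow> (nat \<Rightarrow> nat \<Rightarrow> real) \<Rightarrow> real \<Rightarrow> (nat \<Rightarrow> real) \<Rightarrow> (nat \<Rightarrow> real) \<Rightarrow> bool" where
  "singular_triplet m G \<theta> c d \<longleftrightarrow>
     0 \<le> \<theta> \<and>
     (\<forall>r\<in>{1..m}. (\<Sum>k\<in>{1..m}. G r k * d k) = \<theta> * c r) \<and>
     (\<forall>k\<in>{1..m}. (\<Sum>r\<in>{1..m}. G r k * c r) = \<theta> * d k) \<and>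
     L2_set c {1..m} = 1 \<and> L2_set d {1..m} = 1"

definition lin_comb :: "nat \<Rightarrow> (nat \<Rightarrow> real^'n) \<Rightarrow> (nat \<Rightarrow> real) \<Rightarrow> real^'n" where
  "lin_comb m p c = (\<Sum>k\<in>{1..m}. c k *\<^sub>R p k)"

text \<open>The minimum over an empty index set (here: \<open>m = 1\<close>) is read as \<open>+\<infinity>\<close>, so that the quotient
  is \<open>0\<close>.\<close>

definition quotient_by_min :: "real \<Rightarrow> nat set \<Rightarrow> (nat \<Rightarrow> real) \<Rightarrow> real" where
  "quotient_by_min a I f = (if I = {} then 0 else a / Min (f ` I))"


subsection \<open>The Frobenius norm of \<open>sin \<angle>\<^sub>B\<close>\<close>

text \<open>Matrices with \<open>B\<close>-orthonormal columns are represented by the sets of their columns: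
  \<open>S\<close> is a basis of \<open>W\<close>, the set \<open>T\<close> completes it to a \<open>B\<close>-orthonormal basis of the whole space,
  and \<open>R\<close> is a basis of \<open>Z\<close>.\<close>

definition adapted_bases ::
  "real^'n^'n \<Rightarrow> (real^'n) set \<Rightarrow> (real^'n) set \<Rightarrow>
   (real^'n) set \<Rightarrow> (real^'n) set \<Rightarrow> (real^'n) set \<Rightarrow> bool" where
  "adapted_bases B W Z S T R \<longleftrightarrow>
     b_orthonormal B (S \<union> T) \<and> S \<inter> T = {} \<and> card (S \<union> T) = CARD('n) \<and> span S = W \<and>
     b_orthonormal B R \<and> span R = Z"

text \<open>\<open>frob_cols B T R\<close> is the Frobenius norm of the matrix \<open>T\<^sup>T B R\<close>.\<close>

definition frob_cols :: "real^'n^'n \<Rightarrow> (real^'n) set \<Rightarrow> (real^'n) set \<Rightarrow> real" where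
  "frob_cols B T R = sqrt (\<Sum>w\<in>T. \<Sum>z\<in>R. (b_inner B w z)\<^sup>2)"

definition sin_angle_F :: "real^'n^'n \<Rightarrow> (real^'n) set \<Rightarrow> (real^'n) set \<Rightarrow> real" where
  "sin_angle_F B W Z =
     (SOME r. \<exists>S T R. adapted_bases B W Z S T R \<and> r = frob_cols B T R)"

text \<open>The value does not depend on the bases, see \<open>sin_angle_F_eq\<close> below.\<close>

lemma b_inner_simps:
  "b_inner B (x + y) z = b_inner B x z + b_inner B y z"
  "b_inner B (a *\<^sub>R x) z = a * b_inner B x z"
  "b_inner B (x - y) z = b_inner B x z - b_inner B y z"
  "b_inner B (\<Sum>i\<in>I. f i) z = (\<Sum>i\<in>I. b_inner B (f i) z)"
  by (simp_all add: b_inner_def inner_add_left inner_diff_left inner_sum_left)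

lemma b_inner_commute: "spd B \<Longrightarrow> b_inner B x y = b_inner B y x"
  by (metis b_inner_def dot_lmul_matrix inner_commute spd_def transpose_matrix_vector)

lemma b_orthonormal_independent:
  fixes B :: "real^'n^'n"
  assumes "b_orthonormal B S" shows "independent S" and "finite S"
proof -
  show ind: "independent S"
    unfolding independent_explicit_finite_subsets
  proof (intro allI impI ballI)
    fix F and u :: "real^'n \<Rightarrow> real" and v
    assume F: "F \<subseteq> S" "finite F" "(\<Sum>v\<in>F. u v *\<^sub>R v) = 0" "v \<in> F"
    have "0 = b_inner B (\<Sum>v\<in>F. u v *\<^sub>R v) v"
      using F by (simp add: b_inner_def)
    also have "\<dots> = (\<Sum>x\<in>F. u x * b_inner B x v)"
      by (simp add: b_inner_simps)
    also have "\<dots> = (\<Sum>x\<in>F. if x = v then u x else 0)"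
      using assms F by (intro sum.cong) (auto simp: b_orthonormal_def subset_iff)
    also have "\<dots> = u v" using F by simp
    finally show "u v = 0" by simp
  qed
  then show "finite S" by (simp add: independent_bound)
qed

lemma parseval_span:
  assumes B: "spd B" and S: "b_orthonormal B S" and S': "b_orthonormal B S'"
    and eq: "span S = span S'"
  shows "(\<Sum>w\<in>S. (b_inner B w z)\<^sup>2) = (\<Sum>w\<in>S'. (b_inner B w z)\<^sup>2)"
proof -
  define y where "y X = (\<Sum>w\<in>X. b_inner B w z *\<^sub>R w)" for X
  have orth: "b_inner B x (z - y X) = 0" if X: "b_orthonormal B X" and x: "x \<in> span X" for x X
    using x
  proof (induction rule: span_induct_alt)
    case base
    show ?case by (simp add: b_inner_def)
  next
    case (step c x' x)
    have "b_inner B (y X) x' = (\<Sum>w\<in>X. b_inner B w z * b_inner B w x')"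
      by (simp add: y_def b_inner_simps)
    also have "\<dots> = (\<Sum>w\<in>X. if w = x' then b_inner B w z else 0)"
      using X step by (intro sum.cong) (auto simp: b_orthonormal_def)
    also have "\<dots> = b_inner B x' z"
      using b_orthonormal_independent(2)[OF X] step by simp
    finally have "b_inner B x' (z - y X) = 0"
      using b_inner_commute[OF B] by (metis b_inner_simps(3) eq_iff_diff_eq_0)
    then show ?case using step by (simp add: b_inner_simps)
  qed
  have in_span: "y X \<in> span X" for X
    unfolding y_def by (intro span_sum span_scale span_base)
  let ?d = "y S - y S'"
  have d: "?d \<in> span S" "?d \<in> span S'"
    using in_span[of S] in_span[of S'] eq by (auto intro: span_diff)
  have "b_inner B ?d ?d = b_inner B (z - y S') ?d - b_inner B (z - y S) ?d"
    by (simp add: b_inner_simps)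
  also have "\<dots> = 0"
    using orth[OF S d(1)] orth[OF S' d(2)] b_inner_commute[OF B, of _ ?d] by simp
  finally have "?d = 0"
    using B unfolding spd_def b_inner_def by (metis less_irrefl)
  moreover have "b_inner B (y X) z = (\<Sum>w\<in>X. (b_inner B w z)\<^sup>2)" for X
    by (simp add: y_def b_inner_simps power2_eq_square)
  ultimately show ?thesis by (metis eq_iff_diff_eq_0)
qed

lemma frob_cols_unique:
  assumes B: "spd B" and 1: "adapted_bases B W Z S T R" and 2: "adapted_bases B W Z S' T' R'"
  shows "frob_cols B T R = frob_cols B T' R'"
proof -
  have spanning: "span (X \<union> Y) = UNIV"
    if "adapted_bases B W Z X Y Q" for X Y Q
  proof -
    have "independent (X \<union> Y)"
      using that b_orthonormal_independent unfolding adapted_bases_def by blast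
    then have "UNIV \<subseteq> span (X \<union> Y)"
      using that by (intro card_ge_dim_independent) (auto simp: adapted_bases_def)
    then show ?thesis by auto
  qed
  have split: "(\<Sum>w\<in>Y. (b_inner B w z)\<^sup>2) =
      (\<Sum>w\<in>X \<union> Y. (b_inner B w z)\<^sup>2) - (\<Sum>w\<in>X. (b_inner B w z)\<^sup>2)"
    if "adapted_bases B W Z X Y Q" for X Y Q z
  proof -
    have "finite (X \<union> Y)"
      using that b_orthonormal_independent unfolding adapted_bases_def by blast
    then show ?thesis using that by (simp add: adapted_bases_def sum.union_disjoint)
  qed
  have sub: "b_orthonormal B X" if "adapted_bases B W Z X Y Q" for X Y Q
    using that by (auto simp: adapted_bases_def b_orthonormal_def)
  have cols: "(\<Sum>w\<in>T. (b_inner B w z)\<^sup>2) = (\<Sum>w\<in>T'. (b_inner B w z)\<^sup>2)" for z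
  proof -
    have "(\<Sum>w\<in>S \<union> T. (b_inner B w z)\<^sup>2) = (\<Sum>w\<in>S' \<union> T'. (b_inner B w z)\<^sup>2)"
      using 1 2 spanning[OF 1] spanning[OF 2]
      by (intro parseval_span[OF B]) (auto simp: adapted_bases_def)
    moreover have "(\<Sum>w\<in>S. (b_inner B w z)\<^sup>2) = (\<Sum>w\<in>S'. (b_inner B w z)\<^sup>2)"
      using 1 2 sub[OF 1] sub[OF 2]
      by (intro parseval_span[OF B]) (auto simp: adapted_bases_def)
    ultimately show ?thesis using split[OF 1] split[OF 2] by simp
  qed
  have rows: "(\<Sum>z\<in>R. (b_inner B w z)\<^sup>2) = (\<Sum>z\<in>R'. (b_inner B w z)\<^sup>2)" for w
    using 1 2 parseval_span[OF B, of R R' w] b_inner_commute[OF B, of w]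
    by (simp add: adapted_bases_def)
  have "(\<Sum>w\<in>T. \<Sum>z\<in>R. (b_inner B w z)\<^sup>2) = (\<Sum>w\<in>T. \<Sum>z\<in>R'. (b_inner B w z)\<^sup>2)"
    by (simp add: rows)
  also have "\<dots> = (\<Sum>z\<in>R'. \<Sum>w\<in>T. (b_inner B w z)\<^sup>2)" by (rule sum.swap)
  also have "\<dots> = (\<Sum>z\<in>R'. \<Sum>w\<in>T'. (b_inner B w z)\<^sup>2)" by (simp add: cols)
  also have "\<dots> = (\<Sum>w\<in>T'. \<Sum>z\<in>R'. (b_inner B w z)\<^sup>2)" by (rule sum.swap)
  finally show ?thesis by (simp add: frob_cols_def)
qed

lemma sin_angle_F_eq:
  assumes "spd B" "adapted_bases B W Z S T R"
  shows "sin_angle_F B W Z = frob_cols B T R"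
  unfolding sin_angle_F_def
  by (rule some_equality) (use assms frob_cols_unique in blast)+

end

theory Submission
  imports Defs
begin

text \<open>
  All quantities live in one geometry: \<open>M\<close> is an isometry from the inner product of \<open>B\<close> to the
  Euclidean one, and it turns the \<open>B\<close>-skew operator \<open>C = B\<^sup>-\<^sup>1 A\<close> into the skew matrix \<open>H\<close>. In an
  orthonormal basis, the squared Frobenius norm of the sines between a subspace and \<open>X = span {u, v}\<close>
  is the sum of the squared distances of \<open>u\<close> and \<open>v\<close> from the subspace
  (\<open>sin_angle_F_residual\<close>).

  The Ritz vectors \<open>uR i, vR i\<close> form an orthonormal basis of \<open>U \<oplus> V\<close>. This rests on the orthonormality
  of the Lanczos vectors (\<open>skew_lanczos_orthonormal\<close>), on that of the singular vectors of the
  bidiagonal matrix, and on a dimension count in the Krylov spaces. Hence the squared sine for the pair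
  \<open>j'\<close> is the squared sine for \<open>U \<oplus> V\<close> plus the squared coefficients of \<open>u\<close> and \<open>v\<close> along the Ritz
  vectors of all the other pairs.

  These coefficients are controlled by the gap between \<open>\<sigma>\<close> and the other Ritz values. The compression of \<open>H\<close> to \<open>M (U \<oplus> V)\<close> maps \<open>vR i\<close> to \<open>\<theta> i\<close> times \<open>uR i\<close>
  and \<open>uR i\<close> to \<open>- \<theta> i\<close> times \<open>vR i\<close> (\<open>gsslbd_ritz_relations\<close>, up to the identification by \<open>M\<close>), while
  \<open>H\<close> acts on \<open>u, v\<close> in the same way with \<open>\<sigma>\<close>. Comparing both, the coefficients along pair \<open>i\<close> solve
  small linear systems with smallest singular value \<open>\<bar>\<sigma> - \<theta> i\<bar>\<close> and right-hand sides that are the coefficients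
  of \<open>E u\<close> and \<open>E v\<close>, where \<open>E = P H (I - P)\<close>. Summing over the other pairs gives the bound
  (\<open>compressed_skew_estimate\<close>), since \<open>E\<close> depends on \<open>u\<close> and \<open>v\<close> only through the parts that \<open>P\<close>
  removes, and these parts measure exactly the sine for \<open>U \<oplus> V\<close>.
\<close>

section \<open>The geometry of the inner product induced by \<open>B\<close>\<close>

lemma b_inner_right_simps:
  "b_inner B z (x + y) = b_inner B z x + b_inner B z y"
  "b_inner B z (a *\<^sub>R x) = a * b_inner B z x"
  "b_inner B z (x - y) = b_inner B z x - b_inner B z y"
  "b_inner B z (- x) = - b_inner B z x"
  "b_inner B z (\<Sum>i\<in>I. f i) = (\<Sum>i\<in>I. b_inner B z (f i))"
  "b_inner B z 0 = 0"
  by (simp_all add: b_inner_def matrix_vector_right_distrib matrix_vector_mult_diff_distrib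
      matrix_vector_mult_scaleR inner_add_right inner_sum_right inner_diff_right
      linear_sum[OF matrix_vector_mul_linear] linear_neg[OF matrix_vector_mul_linear])

lemma b_inner_left_simps: "b_inner B (- x) z = - b_inner B x z" "b_inner B 0 z = 0"
  by (simp_all add: b_inner_def)

lemma spd_invertible:
  assumes "spd B" shows "invertible B"
proof -
  have "x = 0" if "B *v x = 0" for x
    using assms that unfolding spd_def by (metis inner_zero_right less_irrefl)
  then show ?thesis
    by (metis invertible_left_inverse matrix_left_invertible_ker)
qed

lemma spd_matrix_inv_vector:
  assumes "spd B"
  shows "B *v (matrix_inv B *v x) = x" "matrix_inv B *v (B *v x) = x"
proof -
  have "B ** matrix_inv B = mat 1 \<and> matrix_inv B ** B = mat 1"
    using spd_invertible[OF assms] unfolding invertible_def matrix_inv_def by (rule someI_ex)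
  then show "B *v (matrix_inv B *v x) = x" "matrix_inv B *v (B *v x) = x"
    by (simp_all add: matrix_vector_mul_assoc)
qed

lemma symmetric_inner:
  fixes M :: "real^'n^'n"
  assumes "transpose M = M" shows "(M *v x) \<bullet> y = x \<bullet> (M *v y)"
  by (metis assms dot_lmul_matrix transpose_matrix_vector)

text \<open>The square root \<open>M\<close> is an isometry from the \<open>B\<close>-geometry to the Euclidean one. This is how the
  Euclidean quantities \<open>H\<close> and \<open>P\<close> of the bound meet the \<open>B\<close>-orthonormal vectors of the process.\<close>

lemma b_inner_sqrt:
  assumes "spd_sqrt M B" shows "b_inner B x y = (M *v x) \<bullet> (M *v y)"
  using assms by (auto simp: b_inner_def spd_sqrt_def spd_def symmetric_inner
      matrix_vector_mul_assoc[symmetric])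

lemma b_inner_self_nonneg: "spd B \<Longrightarrow> 0 \<le> b_inner B x x"
  unfolding spd_def b_inner_def
  by (metis inner_zero_left less_eq_real_def)

lemma b_inner_self_eq_0: "spd B \<Longrightarrow> b_inner B x x = 0 \<longleftrightarrow> x = 0"
  unfolding spd_def b_inner_def
  by (metis inner_zero_left less_irrefl)

text \<open>The vector \<open>r z\<close> is what remains of \<open>z\<close> after the \<open>B\<close>-orthogonal projection onto \<open>span S\<close>; the
  second fact is Pythagoras, which yields Bessel's inequality and, by the third, Parseval's identity.\<close>

lemma b_orthonormal_residual:
  assumes B: "spd B" and S: "b_orthonormal B S"
  defines "r \<equiv> \<lambda>z. z - (\<Sum>w\<in>S. b_inner B w z *\<^sub>R w)"
  shows "x \<in> span S \<Longrightarrow> b_inner B x (r z) = 0"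
    and "b_inner B (r z) (r z) = b_inner B z z - (\<Sum>w\<in>S. (b_inner B w z)\<^sup>2)"
    and "z \<in> span S \<Longrightarrow> r z = 0"
proof -
  note fin = b_orthonormal_independent(2)[OF S]
  have orth: "b_inner B x (r z) = 0" if "x \<in> span S" for x z
    using that
  proof (induction rule: span_induct_alt)
    case base
    show ?case by (simp add: b_inner_def)
  next
    case (step c s x)
    have "(\<Sum>w\<in>S. b_inner B w z * b_inner B s w) = (\<Sum>w\<in>S. if w = s then b_inner B w z else 0)"
      using S step by (intro sum.cong) (auto simp: b_orthonormal_def)
    also have "\<dots> = b_inner B s z" using fin step by simp
    finally have "b_inner B s (r z) = 0"
      by (simp add: r_def b_inner_right_simps)
    then show ?case using step by (simp add: b_inner_simps)
  qed
  then show "x \<in> span S \<Longrightarrow> b_inner B x (r z) = 0" .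
  have proj: "(\<Sum>w\<in>S. b_inner B w z *\<^sub>R w) \<in> span S" for z
    by (intro span_sum span_scale span_base)
  have "b_inner B (r z) (r z) = b_inner B z (r z)"
    using orth[OF proj[of z], of z] by (subst r_def) (simp add: b_inner_simps)
  also have "\<dots> = b_inner B z z - (\<Sum>w\<in>S. b_inner B w z * b_inner B z w)"
    by (simp add: r_def b_inner_right_simps)
  also have "(\<Sum>w\<in>S. b_inner B w z * b_inner B z w) = (\<Sum>w\<in>S. (b_inner B w z)\<^sup>2)"
    by (intro sum.cong refl) (metis b_inner_commute[OF B] power2_eq_square)
  finally show "b_inner B (r z) (r z) = b_inner B z z - (\<Sum>w\<in>S. (b_inner B w z)\<^sup>2)" .
  show "r z = 0" if "z \<in> span S"
  proof -
    have "r z \<in> span S" unfolding r_def using that proj by (intro span_diff) auto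
    then show ?thesis using orth b_inner_self_eq_0[OF B] by blast
  qed
qed

text \<open>Carried over by the isometry \<open>M\<close>, the claim is that an orthonormal set extends by an orthonormal
  basis of its orthogonal complement; that basis is then pulled back by the inverse of \<open>M\<close>.\<close>

lemma b_orthonormal_completion:
  fixes M :: "real^'n^'n"
  assumes B: "spd B" and M: "spd_sqrt M B" and S: "b_orthonormal B S"
  obtains T where "b_orthonormal B (S \<union> T)" "S \<inter> T = {}" "card (S \<union> T) = CARD('n)"
proof -
  have spdM: "spd M" using M by (simp add: spd_sqrt_def)
  have inv: "M *v (matrix_inv M *v x) = x" for x by (rule spd_matrix_inv_vector(1)[OF spdM])
  have inv': "matrix_inv M *v (M *v x) = x" for x by (rule spd_matrix_inv_vector(2)[OF spdM])
  let ?S = "(*v) M ` S"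
  \<comment> \<open>The orthogonal complement of the image of \<open>S\<close>; its dimension supplies the missing vectors.\<close>
  define N where "N = {y. \<forall>x\<in>span ?S. orthogonal x y}"
  have subN: "subspace N"
    unfolding N_def subspace_def by (auto simp: orthogonal_clauses)
  have dimN: "dim N + dim (span ?S) = CARD('n)"
    using dim_subspace_orthogonal_to_vectors[of "span ?S" UNIV]
    by (simp add: N_def dim_UNIV del: dim_span)
  obtain T' where T': "T' \<subseteq> N" "pairwise orthogonal T'" "\<And>x. x \<in> T' \<Longrightarrow> norm x = 1"
     "independent T'" "card T' = dim N" "span T' = N"
    using orthonormal_basis_subspace[OF subN] by metis
  define T where "T = (*v) (matrix_inv M) ` T'"
  have injM: "inj ((*v) M)" using inv' by (metis injI)
  have injI': "inj ((*v) (matrix_inv M))" using inv by (metis injI)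
  have T'T: "x \<in> T \<Longrightarrow> M *v x \<in> T'" for x using inv by (auto simp: T_def)
  have ST: "b_inner B x y = 0" if "x \<in> S" "y \<in> T" for x y
  proof -
    have "M *v y \<in> N" using T' T'T that by auto
    then show ?thesis using that
      by (auto simp: N_def orthogonal_def b_inner_sqrt[OF M] intro!: span_base)
  qed
  have TT: "b_inner B x y = (if x = y then 1 else 0)" if "x \<in> T" "y \<in> T" for x y
  proof (cases "x = y")
    case True
    then show ?thesis using T'(3)[OF T'T[OF that(1)]]
      by (simp add: b_inner_sqrt[OF M] norm_eq_1)
  next
    case False
    then have "M *v x \<noteq> M *v y" using injM by (auto simp: inj_def)
    then show ?thesis using False T'(2) T'T that
      by (auto simp: b_inner_sqrt[OF M] pairwise_def orthogonal_def)
  qed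
  have 1: "b_orthonormal B (S \<union> T)"
    using S ST TT b_inner_commute[OF B] unfolding b_orthonormal_def
    by (smt (verit) UnE)
  have 2: "S \<inter> T = {}"
    using ST TT by fastforce
  have "card ?S = card S" by (intro card_image inj_on_subset[OF injM]) auto
  moreover have "independent ?S"
    using b_orthonormal_independent(1)[OF S] injM
    by (metis linear_independent_injective_image matrix_vector_mul_linear inj_on_subset subset_UNIV)
  ultimately have "dim (span ?S) = card S"
    using dim_eq_card_independent by fastforce
  moreover have "card T = dim N" unfolding T_def
    using T'(5) card_image[OF inj_on_subset[OF injI']] by simp
  moreover have "finite S" "finite T" using b_orthonormal_independent(2)[OF 1] by auto
  ultimately have "card (S \<union> T) = CARD('n)"
    using 2 dimN by (simp add: card_Un_disjoint)
  with 1 2 that show ?thesis by blast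
qed

section \<open>The Frobenius norm of the sines as a sum of residuals\<close>

text \<open>By Parseval in the completed basis, each column \<open>z\<close> contributes to the Frobenius norm the squared
  \<open>B\<close>-length of its component orthogonal to \<open>span S\<close>. In this form the completion has disappeared,
  and angles to nested subspaces can be compared by adding or dropping terms.\<close>

lemma sin_angle_F_residual:
  fixes M :: "real^'n^'n"
  assumes B: "spd B" and M: "spd_sqrt M B" and S: "b_orthonormal B S" and R: "b_orthonormal B R"
  shows "sin_angle_F B (span S) (span R) = sqrt (\<Sum>z\<in>R. 1 - (\<Sum>w\<in>S. (b_inner B w z)\<^sup>2))"
proof -
  obtain T where T: "b_orthonormal B (S \<union> T)" "S \<inter> T = {}" "card (S \<union> T) = CARD('n)"
    using b_orthonormal_completion[OF B M S] .
  have fin: "finite (S \<union> T)" by (rule b_orthonormal_independent(2)[OF T(1)])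
  have "UNIV \<subseteq> span (S \<union> T)"
    using T b_orthonormal_independent(1)[OF T(1)]
    by (intro card_ge_dim_independent) auto
  then have full: "b_inner B z z = (\<Sum>w\<in>S \<union> T. (b_inner B w z)\<^sup>2)" for z
    using b_orthonormal_residual(2,3)[OF B T(1), of z] by (simp add: b_inner_left_simps subset_iff)
  have "(\<Sum>w\<in>T. (b_inner B w z)\<^sup>2) = 1 - (\<Sum>w\<in>S. (b_inner B w z)\<^sup>2)" if "z \<in> R" for z
    using full[of z] R that fin T(2) by (simp add: b_orthonormal_def sum.union_disjoint)
  then have "frob_cols B T R = sqrt (\<Sum>z\<in>R. 1 - (\<Sum>w\<in>S. (b_inner B w z)\<^sup>2))"
    unfolding frob_cols_def by (subst sum.swap) simp
  moreover have "adapted_bases B (span S) (span R) S T R"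
    using T R by (simp add: adapted_bases_def)
  ultimately show ?thesis using sin_angle_F_eq[OF B] by metis
qed

text \<open>Passes from indexed families to the sets of their members, which is the language of the angles:
  orthonormality makes the indexing injective, so that no terms coincide.\<close>

lemma b_orthonormal_families_set:
  fixes a b :: "nat \<Rightarrow> real^'n"
  assumes B: "spd B" and ab: "b_orthonormal_families B k a b" and I: "I \<subseteq> {1..k}"
  shows "b_orthonormal B (a ` I \<union> b ` I)"
    and "(\<Sum>w\<in>a ` I \<union> b ` I. g w) = (\<Sum>i\<in>I. g (a i) + (g (b i) :: 'c :: comm_monoid_add))"
proof -
  have ab': "b_inner B (a i) (a i') = (if i = i' then 1 else 0)"
    "b_inner B (b i) (b i') = (if i = i' then 1 else 0)"
    "b_inner B (a i) (b i') = 0" "b_inner B (b i) (a i') = 0" if "i \<in> I" "i' \<in> I" for i i'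
    using ab subsetD[OF I] that b_inner_commute[OF B, of "b i"]
    unfolding b_orthonormal_families_def by metis+
  have inj: "inj_on a I" "inj_on b I"
    using ab' by (metis inj_onI zero_neq_one)+
  have disj: "a ` I \<inter> b ` I = {}"
  proof (rule ccontr)
    assume "a ` I \<inter> b ` I \<noteq> {}"
    then obtain i i' where "i \<in> I" "i' \<in> I" "a i = b i'" by auto
    then show False using ab'[of i i] ab'[of i i'] by simp
  qed
  show "b_orthonormal B (a ` I \<union> b ` I)"
    unfolding b_orthonormal_def
  proof (intro ballI)
    fix x y assume "x \<in> a ` I \<union> b ` I" "y \<in> a ` I \<union> b ` I"
    then show "b_inner B x y = (if x = y then 1 else 0)"
      using disj by (auto simp: ab' dest: inj_onD[OF inj(1)] inj_onD[OF inj(2)])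
  qed
  have "finite I" using I finite_subset by blast
  then show "(\<Sum>w\<in>a ` I \<union> b ` I. g w) = (\<Sum>i\<in>I. g (a i) + g (b i))"
    using disj inj by (simp add: sum.union_disjoint sum.reindex sum.distrib)
qed

lemma sin_angle_F_families:
  fixes M :: "real^'n^'n"
  assumes B: "spd B" and M: "spd_sqrt M B"
    and ab: "b_orthonormal_families B k a b" "I \<subseteq> {1..k}"
    and uv: "b_orthonormal_families B l u v" "j \<in> {1..l}"
  shows "sin_angle_F B (span (a ` I \<union> b ` I)) (span {u j, v j}) =
    sqrt ((1 - (\<Sum>i\<in>I. (b_inner B (a i) (u j))\<^sup>2 + (b_inner B (b i) (u j))\<^sup>2))
        + (1 - (\<Sum>i\<in>I. (b_inner B (a i) (v j))\<^sup>2 + (b_inner B (b i) (v j))\<^sup>2)))"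
proof -
  have R: "{u j, v j} = u ` {j} \<union> v ` {j}" by auto
  show ?thesis
    unfolding R using uv(2)
    by (subst sin_angle_F_residual[OF B M b_orthonormal_families_set(1)[OF B ab]
          b_orthonormal_families_set(1)[OF B uv(1)]])
      (simp_all add: b_orthonormal_families_set(2)[OF B ab]
          b_orthonormal_families_set(2)[OF B uv(1)] del: image_insert image_empty)
qed

section \<open>Lanczos recurrences for skew operators\<close>

text \<open>One three-term recurrence covers both sequences of the process: with
  \<open>w 0 = q 1, w 1 = p 1, w 2 = q 2, \<dots>\<close> and \<open>\<gamma> = \<alpha> 1, \<beta> 1, \<alpha> 2, \<dots>\<close> the two formulas of GSSLBD differ only
  in the sign \<open>(-1) ^ k\<close>. Orthogonality of a new vector \<open>w (Suc n)\<close> to an old one follows from moving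
  \<open>C\<close> across the inner product: for \<open>w n\<close> itself by skewness, for \<open>w (n - 1)\<close> because the alternating
  signs cancel the two terms with \<open>\<gamma> (n - 1)\<close>, and for older vectors because the recurrence does not reach
  that far. The orthogonality between the \<open>p\<close>'s and the \<open>q\<close>'s is thereby included.\<close>

lemma skew_lanczos_orthonormal:
  fixes C :: "real^'n^'n" and w :: "nat \<Rightarrow> real^'n"
  assumes B: "spd B"
    and skew: "\<And>x y. b_inner B (C *v x) y = - b_inner B x (C *v y)"
    and unit: "\<And>k. k \<le> N \<Longrightarrow> b_inner B (w k) (w k) = 1"
    and nz: "\<And>k. k < N \<Longrightarrow> \<gamma> k \<noteq> 0"
    and step: "\<And>k. k < N \<Longrightarrow>
      C *v w k = (-1) ^ k *\<^sub>R (\<gamma> k *\<^sub>R w (Suc k) + (if k = 0 then 0 else \<gamma> (k - 1) *\<^sub>R w (k - 1)))"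
    and ik: "i \<le> N" "k \<le> N"
  shows "b_inner B (w i) (w k) = (if i = k then 1 else 0)"
proof -
  have "\<forall>i<k. b_inner B (w k) (w i) = 0" if "k \<le> N" for k
    using that
  proof (induction k rule: less_induct)
    case (less k)
    show ?case
    proof (intro allI impI)
      fix i assume "i < k"
      then obtain n where k: "k = Suc n" and i: "i \<le> n" by (cases k) auto
      have n: "n < N" using less.prems k by simp
      have IH: "b_inner B (w a) (w b) = (if a = b then 1 else 0)" if "a \<le> n" "b \<le> n" for a b
      proof (cases a b rule: linorder_cases)
        case less': less
        then show ?thesis using less.IH[of b] that k n b_inner_commute[OF B, of "w a"] by simp
      next
        case equal
        then show ?thesis using unit[of a] that n by simp
      next
        case greater
        then show ?thesis using less.IH[of a] that k n by simp
      qed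
      have eq: "b_inner B (C *v w n) (w i) = (-1) ^ n * (\<gamma> n * b_inner B (w k) (w i)
          + (if n = 0 then 0 else \<gamma> (n - 1) * b_inner B (w (n - 1)) (w i)))"
        by (simp add: step[OF n] k b_inner_simps b_inner_left_simps)
      have "(-1) ^ n * \<gamma> n * b_inner B (w k) (w i) = 0"
      proof (cases "i = n")
        case True
        have "b_inner B (C *v w n) (w n) = 0"
          using skew[of "w n" "w n"] b_inner_commute[OF B, of "w n" "C *v w n"] by simp
        then show ?thesis using eq True by (simp add: IH split: if_splits)
      next
        case False
        then have iN: "i < N" "i < n" using i n by auto
        have "b_inner B (C *v w n) (w i) = - b_inner B (w n) (C *v w i)" by (rule skew)
        also have "\<dots> = - ((-1) ^ i * (\<gamma> i * b_inner B (w n) (w (Suc i))))"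
          using iN by (simp add: step[OF iN(1)] b_inner_right_simps IH)
        also have "\<dots> = (if n = Suc i then (-1) ^ n * \<gamma> (n - 1) else 0)"
          using iN by (simp add: IH)
        finally show ?thesis using eq iN by (auto simp: IH algebra_simps split: if_splits)
      qed
      then show "b_inner B (w k) (w i) = 0" using nz[OF n] by simp
    qed
  qed
  then show ?thesis
    using unit ik b_inner_commute[OF B, of "w i" "w k"] by (metis nat_neq_iff)
qed

section \<open>Orthonormality of the Ritz vectors\<close>

text \<open>Evaluating the bilinear form of \<open>G\<close> in two ways gives \<open>\<theta> X = \<theta>' Y\<close> and \<open>\<theta>' X = \<theta> Y\<close> for the two
  inner products \<open>X\<close> and \<open>Y\<close>; since singular values are nonnegative, \<open>\<theta> \<noteq> \<theta>'\<close> gives \<open>\<theta>\<^sup>2 \<noteq> \<theta>'\<^sup>2\<close>,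
  which forces both to vanish.\<close>

lemma singular_vectors_orthogonal:
  assumes "singular_triplet m G \<theta> c d" "singular_triplet m G \<theta>' c' d'" "\<theta> \<noteq> \<theta>'"
  shows "(\<Sum>k\<in>{1..m}. c k * c' k) = 0" "(\<Sum>k\<in>{1..m}. d k * d' k) = 0"
proof -
  have swap: "s * (\<Sum>k\<in>{1..m}. x k * x' k) = s' * (\<Sum>k\<in>{1..m}. y k * y' k)"
    if "singular_triplet m G s x y" "singular_triplet m G s' x' y'" for s s' x x' y y'
  proof -
    have "s * (\<Sum>k\<in>{1..m}. x k * x' k) = (\<Sum>r\<in>{1..m}. (\<Sum>k\<in>{1..m}. G r k * y k) * x' r)"
      using that by (simp add: singular_triplet_def sum_distrib_left mult.assoc)
    also have "\<dots> = (\<Sum>k\<in>{1..m}. (\<Sum>r\<in>{1..m}. G r k * x' r) * y k)"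
      by (subst sum_distrib_right, subst sum.swap) (simp add: sum_distrib_left sum_distrib_right mult_ac)
    also have "\<dots> = s' * (\<Sum>k\<in>{1..m}. y k * y' k)"
      using that by (simp add: singular_triplet_def sum_distrib_left mult_ac)
    finally show ?thesis .
  qed
  let ?X = "\<Sum>k\<in>{1..m}. c k * c' k" and ?Y = "\<Sum>k\<in>{1..m}. d k * d' k"
  have 1: "\<theta> * ?X = \<theta>' * ?Y" using swap[OF assms(1,2)] .
  have 2: "\<theta>' * ?X = \<theta> * ?Y" using swap[OF assms(2,1)] by (simp add: mult.commute)
  have "\<theta>\<^sup>2 \<noteq> \<theta>'\<^sup>2" using assms by (auto simp: singular_triplet_def power2_eq_iff_nonneg)
  moreover have "\<theta>\<^sup>2 * ?X = \<theta>'\<^sup>2 * ?X"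
    by (simp only: power2_eq_square mult.assoc 1 2 mult.left_commute[of \<theta> \<theta>'])
  moreover have "\<theta>\<^sup>2 * ?Y = \<theta>'\<^sup>2 * ?Y"
    by (simp only: power2_eq_square mult.assoc 1[symmetric] 2[symmetric]
        mult.left_commute[of \<theta> \<theta>'])
  ultimately show "?X = 0" "?Y = 0" by auto
qed

lemma b_inner_lin_comb:
  assumes "\<And>i k. i \<in> {1..m} \<Longrightarrow> k \<in> {1..m} \<Longrightarrow> b_inner B (p i) (q k) = (if i = k then e else 0)"
  shows "b_inner B (lin_comb m p c) (lin_comb m q d) = e * (\<Sum>k\<in>{1..m}. c k * d k)"
proof -
  have "b_inner B (lin_comb m p c) (lin_comb m q d)
      = (\<Sum>i\<in>{1..m}. \<Sum>k\<in>{1..m}. c i * (d k * b_inner B (p i) (q k)))"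
    by (simp only: lin_comb_def b_inner_simps) (simp add: b_inner_right_simps sum_distrib_left)
  also have "\<dots> = (\<Sum>i\<in>{1..m}. \<Sum>k\<in>{1..m}. if i = k then e * (c i * d k) else 0)"
    by (intro sum.cong) (auto simp: assms)
  finally show ?thesis by (simp add: sum_distrib_left)
qed

lemma ritz_vectors_orthonormal:
  assumes pq: "b_orthonormal_families B m p q"
    and G: "\<forall>i\<in>{1..m}. singular_triplet m G (\<theta> i) (c i) (d i)"
    and \<theta>: "inj_on \<theta> {1..m}"
  shows "b_orthonormal_families B m (\<lambda>i. lin_comb m p (c i)) (\<lambda>i. lin_comb m q (d i))"
proof -
  have cd: "(\<Sum>k\<in>{1..m}. c i k * c i' k) = (if i = i' then 1 else 0) \<and>
    (\<Sum>k\<in>{1..m}. d i k * d i' k) = (if i = i' then 1 else 0)"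
    if "i \<in> {1..m}" "i' \<in> {1..m}" for i i'
  proof (cases "i = i'")
    case True
    have "L2_set (c i) {1..m} = 1" "L2_set (d i) {1..m} = 1"
      using G that by (auto simp: singular_triplet_def)
    then show ?thesis
      using True by (simp add: L2_set_def power2_eq_square)
  next
    case False
    then have "\<theta> i \<noteq> \<theta> i'" using \<theta> that by (auto dest: inj_onD)
    then show ?thesis
      using singular_vectors_orthogonal[OF G[rule_format, OF that(1)] G[rule_format, OF that(2)]]
        False by simp
  qed
  show ?thesis
    unfolding b_orthonormal_families_def
  proof (intro ballI conjI)
    fix i i' assume i: "i \<in> {1..m}" "i' \<in> {1..m}"
    note rules = pq[unfolded b_orthonormal_families_def]
    show "b_inner B (lin_comb m p (c i)) (lin_comb m p (c i')) = (if i = i' then 1 else 0)"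
      using b_inner_lin_comb[of m B p p 1 "c i" "c i'"] rules cd[OF i] by simp
    show "b_inner B (lin_comb m q (d i)) (lin_comb m q (d i')) = (if i = i' then 1 else 0)"
      using b_inner_lin_comb[of m B q q 1 "d i" "d i'"] rules cd[OF i] by simp
    show "b_inner B (lin_comb m p (c i)) (lin_comb m q (d i')) = 0"
      using b_inner_lin_comb[of m B p q 0 "c i" "d i'"] rules by simp
  qed
qed

section \<open>The perturbation estimate in Euclidean space\<close>

text \<open>The symmetric matrix with diagonal \<open>s\<close> and off-diagonal \<open>- t\<close> has the eigenvalues \<open>s - t\<close> and
  \<open>s + t\<close>; for nonnegative \<open>s\<close> and \<open>t\<close> the first is the smaller one in modulus.\<close>

lemma ritz_pair_gap:
  fixes s t a b :: real
  assumes "0 \<le> s" "0 \<le> t"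
  shows "(s - t)\<^sup>2 * (a\<^sup>2 + b\<^sup>2) \<le> (s * a - t * b)\<^sup>2 + (s * b - t * a)\<^sup>2"
proof -
  have "(s * a - t * b)\<^sup>2 + (s * b - t * a)\<^sup>2 - (s - t)\<^sup>2 * (a\<^sup>2 + b\<^sup>2) = 2 * (s * t) * (a - b)\<^sup>2"
    by (simp add: power2_eq_square algebra_simps)
  moreover have "0 \<le> 2 * (s * t) * (a - b)\<^sup>2" using assms by simp
  ultimately show ?thesis by linarith
qed

lemma norm2_bound: "norm (C *v x) \<le> norm2 C * norm (x :: real^'n)"
  unfolding norm2_def by (rule onorm[OF matrix_vector_mul_bounded_linear])

lemma orthogonal_projector_fixes:
  assumes "orthogonal_projector P S" "z \<in> S" shows "P *v z = z"
  using assms by (auto simp: orthogonal_projector_def matrix_vector_mul_assoc)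

lemma orthogonal_projector_kills:
  fixes P :: "real^'n^'n"
  assumes P: "orthogonal_projector P (span S)" and z: "\<And>s. s \<in> S \<Longrightarrow> s \<bullet> z = 0"
  shows "P *v z = 0"
proof -
  have "x \<bullet> z = 0" if "x \<in> span S" for x
    using that by (induction rule: span_induct_alt) (auto simp: inner_add_left z)
  then have "(P *v z) \<bullet> z = 0" using P by (auto simp: orthogonal_projector_def)
  moreover have "(P *v z) \<bullet> (P *v z) = (P *v (P *v z)) \<bullet> z"
    using P by (simp add: orthogonal_projector_def symmetric_inner)
  moreover have "P *v (P *v z) = P *v z"
    using P by (simp add: orthogonal_projector_def matrix_vector_mul_assoc)
  ultimately show ?thesis by simp
qed

text \<open>Pair \<open>E y = P (H y) - P (H (P y))\<close> with a Ritz vector \<open>s\<close>. By skewness the second term turns into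
  a pairing of \<open>y\<close> with \<open>P (H s)\<close>, which up to sign is a Ritz value times the partner of \<open>s\<close>.
  Together with \<open>H y = \<sigma> x\<close> and \<open>H x = - \<sigma> y\<close> this gives, for each Ritz pair, two decoupled
  systems of two equations: one for \<open>a i \<bullet> x\<close> and \<open>b i \<bullet> y\<close>, one for \<open>b i \<bullet> x\<close> and \<open>a i \<bullet> y\<close>. Both
  have smallest singular value \<open>\<bar>\<sigma> - \<theta> i\<bar>\<close>. Summing over \<open>i\<close>, Bessel's inequality bounds the right-hand
  sides by the norms of \<open>E x\<close> and \<open>E y\<close>, and \<open>E\<close> only sees the parts of \<open>x\<close> and \<open>y\<close> outside the range
  of \<open>P\<close>, whose squared lengths are \<open>g x\<close> and \<open>g y\<close>. Euclidean orthonormality is expressed as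
  orthonormality with respect to \<open>mat 1\<close>.\<close>

lemma compressed_skew_estimate:
  fixes H P :: "real^'n^'n" and a b :: "nat \<Rightarrow> real^'n" and m :: nat
  defines "E \<equiv> P ** H ** (mat 1 - P)"
  defines "g \<equiv> \<lambda>z. z \<bullet> z - (\<Sum>i\<in>{1..m}. (a i \<bullet> z)\<^sup>2 + (b i \<bullet> z)\<^sup>2)"
  assumes skew: "\<And>x y. (H *v x) \<bullet> y = - (x \<bullet> (H *v y))"
    and P: "orthogonal_projector P (span (a ` {1..m} \<union> b ` {1..m}))"
    and ab: "b_orthonormal_families (mat 1) m a b"
    and Ha: "\<And>i. i \<in> {1..m} \<Longrightarrow> P *v (H *v a i) = - (\<theta> i *\<^sub>R b i)"
    and Hb: "\<And>i. i \<in> {1..m} \<Longrightarrow> P *v (H *v b i) = \<theta> i *\<^sub>R a i"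
    and \<theta>: "\<And>i. i \<in> {1..m} \<Longrightarrow> 0 \<le> \<theta> i"
    and xy: "H *v y = \<sigma> *\<^sub>R x" "H *v x = - (\<sigma> *\<^sub>R y)" and \<sigma>: "0 \<le> \<sigma>"
    and I: "I \<subseteq> {1..m}" and \<delta>: "\<And>i. i \<in> I \<Longrightarrow> \<delta> \<le> (\<sigma> - \<theta> i)\<^sup>2"
  shows "\<delta> * (\<Sum>i\<in>I. (a i \<bullet> x)\<^sup>2 + (b i \<bullet> x)\<^sup>2 + (a i \<bullet> y)\<^sup>2 + (b i \<bullet> y)\<^sup>2)
    \<le> (norm2 E)\<^sup>2 * (g x + g y)"
proof -
  let ?S = "a ` {1..m} \<union> b ` {1..m}"
  have one: "spd (mat 1 :: real^'n^'n)" by (simp add: spd_def)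
  have inner1: "b_inner (mat 1) = ((\<bullet>) :: real^'n \<Rightarrow> _)" by (intro ext) (simp add: b_inner_def)
  note S = b_orthonormal_families_set[OF one ab order_refl]
  note res = b_orthonormal_residual[OF one S(1), unfolded inner1 S(2)]
  have PP: "P *v (P *v z) = P *v z" for z
    using P by (auto simp: orthogonal_projector_def matrix_vector_mul_assoc)
  have Psym: "(P *v z) \<bullet> z' = z \<bullet> (P *v z')" for z z'
    using P by (intro symmetric_inner) (simp add: orthogonal_projector_def)
  note Pfix = orthogonal_projector_fixes[OF P]
  have Pa: "P *v a i = a i" "P *v b i = b i" if "i \<in> {1..m}" for i
    using that by (auto intro!: Pfix span_base)
  have bessel: "(\<Sum>i\<in>{1..m}. (a i \<bullet> z)\<^sup>2 + (b i \<bullet> z)\<^sup>2) \<le> (norm z)\<^sup>2" for z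
  proof -
    have "0 \<le> z \<bullet> z - (\<Sum>i\<in>{1..m}. (a i \<bullet> z)\<^sup>2 + (b i \<bullet> z)\<^sup>2)"
      unfolding res(2)[of z, symmetric] by (rule inner_ge_zero)
    then show ?thesis by (simp add: power2_norm_eq_inner)
  qed
  have g: "(norm (z - P *v z))\<^sup>2 = g z" for z
  proof -
    define y where "y = (\<Sum>i\<in>{1..m}. (a i \<bullet> z) *\<^sub>R a i + (b i \<bullet> z) *\<^sub>R b i)"
    have y: "y \<in> span ?S" unfolding y_def
      by (intro span_sum span_add span_scale span_base) auto
    have "P *v (z - y) = 0"
      using res(1)[of _ z]
      by (intro orthogonal_projector_kills[OF P]) (auto simp: y_def intro: span_base)
    \<comment> \<open>So the matrix \<open>P\<close> is the projection given by the coefficients in the orthonormal basis.\<close>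
    then have "P *v z = y"
      using Pfix[OF y] by (simp add: matrix_vector_mult_diff_distrib)
    then show ?thesis using res(2)[of z] by (simp add: y_def g_def power2_norm_eq_inner)
  qed
  have E: "E *v z = P *v (H *v (z - P *v z))" for z
    by (simp add: E_def matrix_vector_mul_assoc[symmetric] matrix_vector_mult_diff_rdistrib)
  have inE: "s \<bullet> (E *v z) = s \<bullet> (H *v z) + (P *v (H *v s)) \<bullet> z" if "P *v s = s" for s z
  proof -
    have "s \<bullet> (E *v z) = s \<bullet> (H *v (z - P *v z))"
      using Psym[of s] that by (simp add: E)
    also have "\<dots> = s \<bullet> (H *v z) - s \<bullet> (H *v (P *v z))"
      by (simp add: matrix_vector_mult_diff_distrib inner_diff_right)
    also have "s \<bullet> (H *v (P *v z)) = - ((P *v (H *v s)) \<bullet> z)"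
      using skew[of s] Psym by simp
    finally show ?thesis by simp
  qed
  have Ebound: "(norm (E *v z))\<^sup>2 \<le> (norm2 E)\<^sup>2 * g z" for z
  proof -
    have "E *v (z - P *v z) = E *v z"
      by (simp add: E PP matrix_vector_mult_diff_distrib)
    then have "norm (E *v z) \<le> norm2 E * norm (z - P *v z)"
      using norm2_bound[of E "z - P *v z"] by simp
    then show ?thesis using power_mono[OF _ norm_ge_zero] g[of z] by (metis power_mult_distrib)
  qed
  let ?e = "\<lambda>i z. (a i \<bullet> (E *v z))\<^sup>2 + (b i \<bullet> (E *v z))\<^sup>2"
  have term_bound: "\<delta> * ((a i \<bullet> x)\<^sup>2 + (b i \<bullet> x)\<^sup>2 + (a i \<bullet> y)\<^sup>2 + (b i \<bullet> y)\<^sup>2) \<le> ?e i x + ?e i y"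
    if "i \<in> I" for i
  proof -
    have i: "i \<in> {1..m}" using I that by auto
    have eqs: "a i \<bullet> (E *v x) = - (\<sigma> * (a i \<bullet> y) + \<theta> i * (b i \<bullet> x))"
      "b i \<bullet> (E *v x) = - (\<sigma> * (b i \<bullet> y) - \<theta> i * (a i \<bullet> x))"
      "a i \<bullet> (E *v y) = \<sigma> * (a i \<bullet> x) - \<theta> i * (b i \<bullet> y)"
      "b i \<bullet> (E *v y) = \<sigma> * (b i \<bullet> x) + \<theta> i * (a i \<bullet> y)"
      using i by (simp_all add: inE Pa xy Ha Hb)
    have "(\<sigma> - \<theta> i)\<^sup>2 * ((a i \<bullet> x)\<^sup>2 + (b i \<bullet> y)\<^sup>2)
        \<le> (\<sigma> * (a i \<bullet> x) - \<theta> i * (b i \<bullet> y))\<^sup>2 + (\<sigma> * (b i \<bullet> y) - \<theta> i * (a i \<bullet> x))\<^sup>2"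
      by (rule ritz_pair_gap[OF \<sigma> \<theta>[OF i]])
    moreover have "(\<sigma> - \<theta> i)\<^sup>2 * ((b i \<bullet> x)\<^sup>2 + (a i \<bullet> y)\<^sup>2)
        \<le> (\<sigma> * (b i \<bullet> x) + \<theta> i * (a i \<bullet> y))\<^sup>2 + (\<sigma> * (a i \<bullet> y) + \<theta> i * (b i \<bullet> x))\<^sup>2"
      using ritz_pair_gap[OF \<sigma> \<theta>[OF i], of "b i \<bullet> x" "- (a i \<bullet> y)"]
      by (simp add: power2_eq_square algebra_simps)
    ultimately have "(\<sigma> - \<theta> i)\<^sup>2 * ((a i \<bullet> x)\<^sup>2 + (b i \<bullet> x)\<^sup>2 + (a i \<bullet> y)\<^sup>2 + (b i \<bullet> y)\<^sup>2)
        \<le> ?e i x + ?e i y"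
      unfolding eqs power2_minus distrib_left by linarith
    moreover have "\<delta> * ((a i \<bullet> x)\<^sup>2 + (b i \<bullet> x)\<^sup>2 + (a i \<bullet> y)\<^sup>2 + (b i \<bullet> y)\<^sup>2)
        \<le> (\<sigma> - \<theta> i)\<^sup>2 * ((a i \<bullet> x)\<^sup>2 + (b i \<bullet> x)\<^sup>2 + (a i \<bullet> y)\<^sup>2 + (b i \<bullet> y)\<^sup>2)"
      using \<delta>[OF that] by (intro mult_right_mono) auto
    ultimately show ?thesis by linarith
  qed
  have "\<delta> * (\<Sum>i\<in>I. (a i \<bullet> x)\<^sup>2 + (b i \<bullet> x)\<^sup>2 + (a i \<bullet> y)\<^sup>2 + (b i \<bullet> y)\<^sup>2)
      \<le> (\<Sum>i\<in>I. ?e i x + ?e i y)"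
    unfolding sum_distrib_left using term_bound by (rule sum_mono)
  also have "\<dots> \<le> (\<Sum>i\<in>{1..m}. ?e i x + ?e i y)"
    using I by (intro sum_mono2) auto
  also have "\<dots> \<le> (norm (E *v x))\<^sup>2 + (norm (E *v y))\<^sup>2"
    using bessel[of "E *v x"] bessel[of "E *v y"] by (simp add: sum.distrib)
  also have "\<dots> \<le> (norm2 E)\<^sup>2 * (g x + g y)"
    using Ebound[of x] Ebound[of y] by (simp add: distrib_left)
  finally show ?thesis .
qed

section \<open>The GSSLBD process\<close>

lemma skew_symmetric_b_inner:
  assumes A: "skew_symmetric A" and B: "spd B"
  shows "b_inner B ((matrix_inv B ** A) *v x) y = - b_inner B x ((matrix_inv B ** A) *v y)"
proof -
  have BC: "b_inner B z ((matrix_inv B ** A) *v z') = z \<bullet> (A *v z')" for z z'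
    by (simp add: b_inner_def matrix_vector_mul_assoc[symmetric] spd_matrix_inv_vector[OF B])
  have "y \<bullet> (A *v x) = (transpose A *v y) \<bullet> x"
    by (simp add: dot_lmul_matrix)
  also have "transpose A *v y = - (A *v y)"
    using A by (simp add: skew_symmetric_def vec_eq_iff matrix_vector_mult_def sum_negf)
  finally have "y \<bullet> (A *v x) = - (x \<bullet> (A *v y))"
    by (simp add: inner_commute)
  then show ?thesis by (simp add: b_inner_commute[OF B, of "_ *v x"] BC)
qed

lemma b_inner_normalized:
  assumes "spd B" "b_norm B s \<noteq> 0"
  shows "b_inner B (s /\<^sub>R b_norm B s) (s /\<^sub>R b_norm B s) = 1"
proof -
  have "b_inner B s s = b_norm B s * b_norm B s"
    using b_inner_self_nonneg[OF assms(1)] by (simp add: b_norm_def)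
  then show ?thesis using assms(2) by (simp add: b_inner_simps b_inner_right_simps field_simps)
qed

lemma gsslbd_recurrences:
  fixes A B :: "real^'n^'n"
  defines "C \<equiv> matrix_inv B ** A"
  assumes B: "spd B" and proc: "gsslbd_process A B m \<alpha> \<beta> p q" "no_breakdown m \<alpha> \<beta>"
    and k: "k \<in> {1..m}"
  shows "C *v q k = \<alpha> k *\<^sub>R p k + \<beta> (k - 1) *\<^sub>R p (k - 1)"
    and "C *v p k = - (\<alpha> k *\<^sub>R q k + \<beta> k *\<^sub>R q (k + 1))"
    and "b_inner B (p k) (p k) = 1" "b_inner B (q (k + 1)) (q (k + 1)) = 1"
proof -
  define s where "s = C *v q k - \<beta> (k - 1) *\<^sub>R p (k - 1)"
  define t where "t = - (C *v p k) - \<alpha> k *\<^sub>R q k"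
  have eqs: "\<alpha> k = b_norm B s" "p k = s /\<^sub>R \<alpha> k" "\<beta> k = b_norm B t" "q (k + 1) = t /\<^sub>R \<beta> k"
    using proc(1) k unfolding gsslbd_process_def s_def t_def C_def
    by (auto simp: Let_def matrix_vector_mul_assoc)
  have nz: "\<alpha> k \<noteq> 0" "\<beta> k \<noteq> 0" using proc(2) k by (auto simp: no_breakdown_def)
  show "b_inner B (p k) (p k) = 1" "b_inner B (q (k + 1)) (q (k + 1)) = 1"
    using b_inner_normalized[OF B, of s] b_inner_normalized[OF B, of t] eqs nz by simp_all
  have "\<alpha> k *\<^sub>R p k = s" "\<beta> k *\<^sub>R q (k + 1) = t"
    using nz unfolding eqs(2,4) by simp_all
  then show "C *v q k = \<alpha> k *\<^sub>R p k + \<beta> (k - 1) *\<^sub>R p (k - 1)"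
    and "C *v p k = - (\<alpha> k *\<^sub>R q k + \<beta> k *\<^sub>R q (k + 1))"
    by (simp_all add: s_def t_def)
qed

text \<open>The vector \<open>q (m + 1)\<close>, computed in the last step, is included because it appears in the residual
  of the Ritz relations and has to be annihilated by the projection.\<close>

lemma gsslbd_orthonormal:
  fixes A B :: "real^'n^'n"
  assumes A: "skew_symmetric A" and B: "spd B" and q1: "b_norm B (q 1) = 1"
    and proc: "gsslbd_process A B m \<alpha> \<beta> p q" "no_breakdown m \<alpha> \<beta>"
  shows "b_orthonormal_families B m p q"
    and "k \<in> {1..m} \<Longrightarrow> b_inner B (p k) (q (m + 1)) = 0"
    and "k \<in> {1..m} \<Longrightarrow> b_inner B (q k) (q (m + 1)) = 0"
proof -
  \<comment> \<open>The interleaved sequences start at index 0, so that the even members are the \<open>q\<close>'s.\<close>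
  define w where "w k = (if even k then q (k div 2 + 1) else p (k div 2 + 1))" for k
  define \<gamma> where "\<gamma> k = (if even k then \<alpha> (k div 2 + 1) else \<beta> (k div 2 + 1))" for k
  note rec = gsslbd_recurrences[OF B proc]
  have \<beta>0: "\<beta> 0 = 0" using proc(1) by (simp add: gsslbd_process_def)
  have unit: "b_inner B (w k) (w k) = 1" if "k \<le> 2 * m" for k
  proof (cases "k = 0")
    case True
    then show ?thesis using q1 by (simp add: w_def b_norm_def)
  next
    case False
    then show ?thesis
      using rec(4)[of "k div 2"] rec(3)[of "k div 2 + 1"] that by (auto simp: w_def elim!: evenE oddE)
  qed
  have nz: "\<gamma> k \<noteq> 0" if "k < 2 * m" for k
  proof -
    have "k div 2 + 1 \<in> {1..m}" using that by auto
    then show ?thesis using proc(2) by (simp add: \<gamma>_def no_breakdown_def)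
  qed
  have step: "(matrix_inv B ** A) *v w k = (-1) ^ k *\<^sub>R
      (\<gamma> k *\<^sub>R w (Suc k) + (if k = 0 then 0 else \<gamma> (k - 1) *\<^sub>R w (k - 1)))"
    if "k < 2 * m" for k
  proof (cases "even k")
    case True
    then obtain i where k: "k = 2 * i" by (elim evenE)
    show ?thesis
    proof (cases i)
      case 0
      then show ?thesis using rec(1)[of 1] that k by (simp add: w_def \<gamma>_def \<beta>0)
    next
      case (Suc i')
      then show ?thesis using rec(1)[of "i + 1"] that k by (simp add: w_def \<gamma>_def)
    qed
  next
    case False
    then obtain i where k: "k = 2 * i + 1" by (elim oddE)
    then show ?thesis using rec(2)[of "i + 1"] that by (simp add: w_def \<gamma>_def)
  qed
  have orth: "b_inner B (w i) (w k) = (if i = k then 1 else 0)" if "i \<le> 2 * m" "k \<le> 2 * m" for i k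
    by (rule skew_lanczos_orthonormal[OF B skew_symmetric_b_inner[OF A B] unit nz step that])
  have q: "q k = w (2 * (k - 1))" and p: "p k = w (2 * (k - 1) + 1)" if "1 \<le> k" for k
    using that by (simp_all add: w_def)
  show "b_orthonormal_families B m p q"
    unfolding b_orthonormal_families_def
  proof (intro ballI conjI)
    fix i k assume ik: "i \<in> {1..m}" "k \<in> {1..m}"
    then have le: "2 * (i - 1) + 1 \<le> 2 * m" "2 * (k - 1) + 1 \<le> 2 * m" and eq: "i - 1 = k - 1 \<longleftrightarrow> i = k"
      by auto
    show "b_inner B (p i) (p k) = (if i = k then 1 else 0)"
      "b_inner B (q i) (q k) = (if i = k then 1 else 0)"
      using ik le eq by (auto simp: p q orth)
    have "2 * (i - 1) + 1 \<noteq> 2 * (k - 1)" by presburger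
    then show "b_inner B (p i) (q k) = 0"
      using ik le by (simp add: p q orth)
  qed
  assume k: "k \<in> {1..m}"
  have "2 * (k - 1) + 1 < 2 * m" "2 * (k - 1) < 2 * m" using k by auto
  then show "b_inner B (p k) (q (m + 1)) = 0" "b_inner B (q k) (q (m + 1)) = 0"
    using k by (simp_all add: p q orth del: One_nat_def)
qed

section \<open>The Krylov spaces\<close>

lemma subspace_krylov: "subspace (krylov k D b)"
  by (simp add: krylov_def)

lemma krylov_power: "i < k \<Longrightarrow> ((*v) D ^^ i) b \<in> krylov k D b"
  unfolding krylov_def by (intro span_base) auto

lemma krylov_mono: "k \<le> k' \<Longrightarrow> krylov k D b \<subseteq> krylov k' D b"
  unfolding krylov_def by (intro span_mono image_mono) auto

lemma krylov_mult_closed: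
  assumes x: "x \<in> krylov k D b" and S: "subspace S"
    and gen: "\<And>i. i < k \<Longrightarrow> C *v (((*v) D ^^ i) b) \<in> S"
  shows "C *v x \<in> S"
  using x unfolding krylov_def
proof (induction rule: span_induct_alt)
  case base
  show ?case using subspace_0[OF S] by simp
next
  case (step c y z)
  then show ?case using gen S
    by (auto simp: matrix_vector_right_distrib matrix_vector_mult_scaleR
        intro!: subspace_add subspace_scale)
qed

text \<open>Since \<open>C (q 1)\<close> is a multiple of \<open>p 1\<close> and \<open>C\<close> commutes with \<open>D = C\<^sup>2\<close>, the map \<open>C\<close> sends
  \<open>krylov i D (q 1)\<close> into \<open>krylov i D (p 1)\<close>, and the latter into \<open>krylov (Suc i) D (q 1)\<close>. Following the
  recurrences, the memberships propagate from one step to the next.\<close>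

lemma gsslbd_krylov:
  fixes A B :: "real^'n^'n"
  assumes B: "spd B" and proc: "gsslbd_process A B m \<alpha> \<beta> p q" "no_breakdown m \<alpha> \<beta>"
    and k: "k \<in> {1..m}"
  shows "p k \<in> krylov_space A B m (p 1)" "q k \<in> krylov_space A B m (q 1)"
proof -
  define C where "C = matrix_inv B ** A"
  define D where "D = C ** C"
  note rec = gsslbd_recurrences(1,2)[OF B proc, folded C_def]
  have nz: "\<alpha> k \<noteq> 0 \<and> \<beta> k \<noteq> 0" if "k \<in> {1..m}" for k
    using proc(2) that by (auto simp: no_breakdown_def)
  have Cq1: "C *v q 1 = \<alpha> 1 *\<^sub>R p 1" and \<alpha>1: "\<alpha> 1 \<noteq> 0"
    using rec(1)[of 1] nz[of 1] proc(1) k by (auto simp: gsslbd_process_def)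
  have comm: "C *v (((*v) D ^^ i) b) = ((*v) D ^^ i) (C *v b)" for i b
    by (induction i) (simp_all add: D_def matrix_vector_mul_assoc[symmetric])
  have scale: "((*v) D ^^ i) (a *\<^sub>R b) = a *\<^sub>R ((*v) D ^^ i) b" for i a and b :: "real^'n"
    by (induction i) (simp_all add: matrix_vector_mult_scaleR)
  have Dq1: "D *v q 1 = \<alpha> 1 *\<^sub>R (C *v p 1)"
    by (simp add: D_def matrix_vector_mul_assoc[symmetric] Cq1 matrix_vector_mult_scaleR del: One_nat_def)
  have CV: "C *v x \<in> krylov i D (p 1)" if "x \<in> krylov i D (q 1)" for x i
    using that subspace_krylov
    by (rule krylov_mult_closed)
      (auto simp: comm Cq1 scale intro!: subspace_scale[OF subspace_krylov] krylov_power
        simp del: One_nat_def)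
  have CU: "C *v x \<in> krylov (Suc i) D (q 1)" if "x \<in> krylov i D (p 1)" for x i
    using that subspace_krylov
  proof (rule krylov_mult_closed)
    fix r assume r: "r < i"
    have "C *v (((*v) D ^^ r) (p 1)) = (1 / \<alpha> 1) *\<^sub>R ((*v) D ^^ Suc r) (q 1)"
      using \<alpha>1 by (simp add: comm funpow_Suc_right Dq1 scale del: funpow.simps One_nat_def)
    also have "\<dots> \<in> krylov (Suc i) D (q 1)"
      using r by (intro subspace_scale[OF subspace_krylov] krylov_power) simp
    finally show "C *v (((*v) D ^^ r) (p 1)) \<in> krylov (Suc i) D (q 1)" .
  qed
  have "p k \<in> krylov k D (p 1) \<and> q k \<in> krylov k D (q 1)"
    using k
  proof (induction k rule: nat_induct)
    case 0
    then show ?case by simp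
  next
    case (Suc i)
    show ?case
    proof (cases "i = 0")
      case True
      then show ?thesis using krylov_power[of 0 1 D] by simp
    next
      case False
      then have i: "i \<in> {1..m}" using Suc.prems by auto
      then have IH: "p i \<in> krylov i D (p 1)" "q i \<in> krylov i D (q 1)" using Suc.IH by auto
      have "q (Suc i) = (- 1 / \<beta> i) *\<^sub>R (C *v p i + \<alpha> i *\<^sub>R q i)"
        using rec(2)[OF i] nz[OF i] by simp
      also have "\<dots> \<in> krylov (Suc i) D (q 1)"
        using CU[OF IH(1)] IH(2) krylov_mono[of i "Suc i"]
        by (intro subspace_scale subspace_add subspace_krylov) auto
      finally have q: "q (Suc i) \<in> krylov (Suc i) D (q 1)" .
      have "p (Suc i) = (1 / \<alpha> (Suc i)) *\<^sub>R (C *v q (Suc i) - \<beta> i *\<^sub>R p i)"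
        using rec(1)[OF Suc.prems] nz[OF Suc.prems] by simp
      also have "\<dots> \<in> krylov (Suc i) D (p 1)"
        using CV[OF q] IH(1) krylov_mono[of i "Suc i"]
        by (intro subspace_scale subspace_diff subspace_krylov) auto
      finally show ?thesis using q by simp
    qed
  qed
  then show "p k \<in> krylov_space A B m (p 1)" "q k \<in> krylov_space A B m (q 1)"
    using k krylov_mono[of k m] by (auto simp: krylov_space_def C_def D_def)
qed

section \<open>Ritz relations\<close>

text \<open>Columns and rows of the bidiagonal matrix as combinations of vectors. The column sum is one full
  side of the process recurrence, whereas the last row misses the term with \<open>\<beta> m\<close>.\<close>

lemma bidiag_sums:
  fixes f :: "nat \<Rightarrow> 'a :: real_vector"
  assumes "k \<in> {1..m}"
  shows "(\<Sum>r\<in>{1..m}. bidiag \<alpha> \<beta> r k *\<^sub>R f r)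
      = \<alpha> k *\<^sub>R f k + (if k = 1 then 0 else \<beta> (k - 1) *\<^sub>R f (k - 1))"
    and "(\<Sum>r\<in>{1..m}. bidiag \<alpha> \<beta> k r *\<^sub>R f r)
      = \<alpha> k *\<^sub>R f k + (if k = m then 0 else \<beta> k *\<^sub>R f (k + 1))"
proof -
  have "(\<Sum>r\<in>{1..m}. bidiag \<alpha> \<beta> r k *\<^sub>R f r) = (\<Sum>r\<in>{1..m}. (if r = k then \<alpha> k *\<^sub>R f k else 0)
      + (if r = k - 1 then \<beta> (k - 1) *\<^sub>R f (k - 1) else 0))"
    using assms by (intro sum.cong) (auto simp: bidiag_def)
  also have "\<dots> = \<alpha> k *\<^sub>R f k + (if k = 1 then 0 else \<beta> (k - 1) *\<^sub>R f (k - 1))"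
    using assms by (auto simp: sum.distrib)
  finally show "(\<Sum>r\<in>{1..m}. bidiag \<alpha> \<beta> r k *\<^sub>R f r)
      = \<alpha> k *\<^sub>R f k + (if k = 1 then 0 else \<beta> (k - 1) *\<^sub>R f (k - 1))" .
  have "(\<Sum>r\<in>{1..m}. bidiag \<alpha> \<beta> k r *\<^sub>R f r) = (\<Sum>r\<in>{1..m}. (if r = k then \<alpha> k *\<^sub>R f k else 0)
      + (if r = k + 1 then \<beta> k *\<^sub>R f (k + 1) else 0))"
    using assms by (intro sum.cong) (auto simp: bidiag_def)
  also have "\<dots> = \<alpha> k *\<^sub>R f k + (if k = m then 0 else \<beta> k *\<^sub>R f (k + 1))"
    using assms by (auto simp: sum.distrib)
  finally show "(\<Sum>r\<in>{1..m}. bidiag \<alpha> \<beta> k r *\<^sub>R f r)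
      = \<alpha> k *\<^sub>R f k + (if k = m then 0 else \<beta> k *\<^sub>R f (k + 1))" .
qed

lemma mult_lin_comb: "C *v lin_comb m p c = lin_comb m (\<lambda>k. C *v p k) c"
  by (simp add: lin_comb_def linear_sum[OF matrix_vector_mul_linear] matrix_vector_mult_scaleR)

lemma lin_comb_matrix:
  assumes "\<And>r. r \<in> {1..m} \<Longrightarrow> (\<Sum>k\<in>{1..m}. G r k * d k) = \<theta> * c r"
  shows "lin_comb m (\<lambda>k. \<Sum>r\<in>{1..m}. G r k *\<^sub>R p r) d = \<theta> *\<^sub>R lin_comb m p c"
proof -
  have "lin_comb m (\<lambda>k. \<Sum>r\<in>{1..m}. G r k *\<^sub>R p r) d
      = (\<Sum>r\<in>{1..m}. \<Sum>k\<in>{1..m}. (G r k * d k) *\<^sub>R p r)"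
    unfolding lin_comb_def scaleR_sum_right by (subst sum.swap) (simp add: mult.commute)
  also have "\<dots> = (\<Sum>r\<in>{1..m}. (\<theta> * c r) *\<^sub>R p r)"
    by (intro sum.cong refl) (simp add: scaleR_sum_left[symmetric] assms del: One_nat_def)
  finally show ?thesis by (simp add: lin_comb_def scaleR_sum_right)
qed

text \<open>The first relation is exact; the second has a residual in the direction \<open>q (m + 1)\<close>, coming from the
  entry \<open>\<beta> m\<close> that lies outside the \<open>m \<times> m\<close> matrix.\<close>

lemma gsslbd_ritz_relations:
  fixes A B :: "real^'n^'n"
  defines "C \<equiv> matrix_inv B ** A"
  assumes B: "spd B" and proc: "gsslbd_process A B m \<alpha> \<beta> p q" "no_breakdown m \<alpha> \<beta>"
    and G: "singular_triplet m (bidiag \<alpha> \<beta>) \<theta> c d" and m: "1 \<le> m"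
  shows "C *v lin_comb m q d = \<theta> *\<^sub>R lin_comb m p c"
    and "C *v lin_comb m p c = - (\<theta> *\<^sub>R lin_comb m q d) - (\<beta> m * c m) *\<^sub>R q (m + 1)"
proof -
  note rec = gsslbd_recurrences(1,2)[OF B proc, folded C_def]
  have \<beta>0: "\<beta> 0 = 0" using proc(1) by (simp add: gsslbd_process_def)
  have "C *v lin_comb m q d = lin_comb m (\<lambda>k. \<Sum>r\<in>{1..m}. bidiag \<alpha> \<beta> r k *\<^sub>R p r) d"
    unfolding mult_lin_comb unfolding lin_comb_def
    using rec(1) \<beta>0 by (intro sum.cong refl) (simp add: bidiag_sums(1) del: One_nat_def)
  then show "C *v lin_comb m q d = \<theta> *\<^sub>R lin_comb m p c"
    using lin_comb_matrix[of m "bidiag \<alpha> \<beta>" d \<theta> c p] G by (simp add: singular_triplet_def)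
  let ?g = "\<lambda>k. \<Sum>r\<in>{1..m}. bidiag \<alpha> \<beta> k r *\<^sub>R q r"
  have "C *v lin_comb m p c
      = (\<Sum>k\<in>{1..m}. - (c k *\<^sub>R ?g k) - (if k = m then (\<beta> m * c m) *\<^sub>R q (m + 1) else 0))"
    unfolding mult_lin_comb unfolding lin_comb_def
    using rec(2)
    by (intro sum.cong refl)
      (auto simp: bidiag_sums(2) scaleR_add_right scaleR_diff_right mult.commute simp del: One_nat_def)
  also have "\<dots> = - lin_comb m ?g c - (\<beta> m * c m) *\<^sub>R q (m + 1)"
    using m by (simp add: lin_comb_def sum_subtractf sum_negf)
  also have "lin_comb m ?g c = \<theta> *\<^sub>R lin_comb m q d"
    using lin_comb_matrix[of m "\<lambda>r k. bidiag \<alpha> \<beta> k r" c \<theta> d q] G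
    by (simp add: singular_triplet_def)
  finally show "C *v lin_comb m p c = - (\<theta> *\<^sub>R lin_comb m q d) - (\<beta> m * c m) *\<^sub>R q (m + 1)" .
qed

lemma lin_comb_in_subspace:
  "subspace S \<Longrightarrow> (\<And>k. k \<in> {1..m} \<Longrightarrow> p k \<in> S) \<Longrightarrow> lin_comb m p c \<in> S"
  unfolding lin_comb_def by (intro subspace_sum subspace_scale) auto

section \<open>The bound for generalized Ritz approximations\<close>

text \<open>A dimension count: the sum of the two Krylov spaces has \<open>2 * m\<close> generators and contains the
  \<open>2 * m\<close> independent vectors of the families.\<close>

lemma span_families_eq_krylov_sum:
  fixes a b :: "nat \<Rightarrow> real^'n"
  assumes B: "spd B" and ab: "b_orthonormal_families B m a b"
    and "\<And>i. i \<in> {1..m} \<Longrightarrow> a i \<in> krylov m D x" "\<And>i. i \<in> {1..m} \<Longrightarrow> b i \<in> krylov m D y"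
  shows "span (a ` {1..m} \<union> b ` {1..m}) = subspace_sum (krylov m D x) (krylov m D y)"
proof -
  let ?S = "a ` {1..m} \<union> b ` {1..m}"
  let ?X = "(\<lambda>k. ((*v) D ^^ k) x) ` {..<m}" and ?Y = "(\<lambda>k. ((*v) D ^^ k) y) ` {..<m}"
  have sum: "subspace_sum (krylov m D x) (krylov m D y) = span (?X \<union> ?Y)"
    by (simp add: subspace_sum_def krylov_def span_Un)
  have "card (?X \<union> ?Y) \<le> card ?X + card ?Y" by (rule card_Un_le)
  also have "\<dots> \<le> m + m"
    using card_image_le[of "{..<m}"] by (metis add_mono card_lessThan finite_lessThan)
  also have "\<dots> = card ?S"
    using b_orthonormal_families_set(2)[OF B ab order_refl, of "\<lambda>_. 1::nat"] by simp
  finally have dim: "dim (?X \<union> ?Y) \<le> card ?S"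
    using dim_le_card'[of "?X \<union> ?Y"] by simp
  have "a i \<in> span (?X \<union> ?Y)" "b i \<in> span (?X \<union> ?Y)" if "i \<in> {1..m}" for i
    using assms(3,4)[OF that] span_mono[of ?X "?X \<union> ?Y"] span_mono[of ?Y "?X \<union> ?Y"]
    by (auto simp: krylov_def)
  then have sub: "?S \<subseteq> span (?X \<union> ?Y)" by auto
  have ind: "independent ?S"
    by (rule b_orthonormal_independent(1)[OF b_orthonormal_families_set(1)[OF B ab order_refl]])
  have "span (?X \<union> ?Y) \<subseteq> span ?S"
    by (rule card_ge_dim_independent[OF sub ind]) (simp only: dim dim_span)
  then show ?thesis
    unfolding sum using sub by (simp add: span_minimal subset_antisym)
qed

lemma conjugated_pencil:
  fixes M :: "real^'n^'n"
  assumes B: "spd B" and M: "spd_sqrt M B"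
  shows "(matrix_inv M ** A ** matrix_inv M) *v (M *v x) = M *v ((matrix_inv B ** A) *v x)"
proof -
  have spdM: "spd M" and MM: "B = M ** M" using M by (auto simp: spd_sqrt_def)
  have "M *v (M *v (matrix_inv B *v y)) = y" for y
    using spd_matrix_inv_vector(1)[OF B, of y]
    by (simp add: MM matrix_vector_mul_assoc matrix_mul_assoc)
  then have "M *v (matrix_inv B *v y) = matrix_inv M *v y" for y
    by (metis spd_matrix_inv_vector(2)[OF spdM])
  then show ?thesis
    by (simp add: matrix_vector_mul_assoc[symmetric] spd_matrix_inv_vector[OF spdM])
qed

theorem theorem3p3:
  fixes A B M H P :: "real^'n^'n"
    and \<sigma> \<alpha> \<beta> \<theta> :: "nat \<Rightarrow> real"
    and u v p q uR vR :: "nat \<Rightarrow> real^'n"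
    and c d :: "nat \<Rightarrow> nat \<Rightarrow> real"
    and U V :: "(real^'n) set"
    and l m j j' :: nat
  assumes "skew_symmetric A" and "spd B"
    and "rank A = 2 * l"
    and "strict_antimono_on {1..l} \<sigma>" and "\<forall>k\<in>{1..l}. 0 < \<sigma> k"
    and "{\<mu>. \<mu> \<noteq> 0 \<and> pencil_eigenvalue A B \<mu>} =
           (\<Union>k\<in>{1..l}. {\<i> * complex_of_real (\<sigma> k), - (\<i> * complex_of_real (\<sigma> k))})"
    and "\<forall>\<mu>. \<mu> \<noteq> 0 \<and> pencil_eigenvalue A B \<mu> \<longrightarrow> simple_pencil_eigenvalue A B \<mu>"
    and "\<forall>k\<in>{1..l}. generalized_spectral_triplet A B (\<sigma> k) (u k) (v k)"
    and "b_orthonormal_families B l u v"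
    and "m < l"
    and "b_norm B (q 1) = 1"
    and "gsslbd_process A B m \<alpha> \<beta> p q" and "no_breakdown m \<alpha> \<beta>"
    and "U = krylov_space A B m (p 1)" and "V = krylov_space A B m (q 1)"
    and "\<forall>i\<in>{1..m}. singular_triplet m (bidiag \<alpha> \<beta>) (\<theta> i) (c i) (d i)"
    and "strict_antimono_on {1..m} \<theta>"
    and "\<forall>i\<in>{1..m}. uR i = lin_comb m p (c i) \<and> vR i = lin_comb m q (d i)"
    and "j \<in> {1..l}" and "j' \<in> {1..m}"
    and "\<forall>i\<in>{1..m}. \<bar>\<sigma> j - \<theta> j'\<bar> \<le> \<bar>\<sigma> j - \<theta> i\<bar>"
    and "spd_sqrt M B"
    and "H = matrix_inv M ** A ** matrix_inv M"
    and "orthogonal_projector P (subspace_sum ((*v) M ` U) ((*v) M ` V))"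
  shows "sin_angle_F B (span {uR j', vR j'}) (span {u j, v j})
         \<le> sqrt (1 + quotient_by_min ((norm2 (P ** H ** (mat 1 - P)))\<^sup>2)
                        ({1..m} - {j'}) (\<lambda>i. \<bar>\<sigma> j - \<theta> i\<bar>\<^sup>2))
           * sin_angle_F B (subspace_sum U V) (span {u j, v j})"
proof -
  note A = assms(1) and B = assms(2) and uv = assms(9) and proc = assms(12,13)
    and G = assms(16) and jl = assms(19) and j'm = assms(20) and M = assms(22)
  let ?I = "{1..m}" and ?J = "{1..m} - {j'}"
  let ?C = "matrix_inv B ** A" and ?E = "P ** H ** (mat 1 - P)"
  let ?S = "uR ` ?I \<union> vR ` ?I"
  have uR: "uR i = lin_comb m p (c i)" and vR: "vR i = lin_comb m q (d i)" if "i \<in> ?I" for i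
    using assms(18) that by auto
  have inj\<theta>: "inj_on \<theta> ?I"
    using assms(17) by (intro inj_onI) (metis monotone_onD less_irrefl linorder_neqE_nat)
  have ritz: "b_orthonormal_families B m uR vR"
    using ritz_vectors_orthonormal[OF gsslbd_orthonormal(1)[OF A B assms(11) proc] G inj\<theta>]
    by (simp add: b_orthonormal_families_def uR vR)
  have UV: "subspace U" "subspace V"
    by (simp_all add: assms(14,15) krylov_space_def subspace_krylov)
  have "uR i \<in> krylov_space A B m (p 1)" "vR i \<in> krylov_space A B m (q 1)" if "i \<in> ?I" for i
    using UV gsslbd_krylov[OF B proc] unfolding uR[OF that] vR[OF that] assms(14,15)
    by (auto intro!: lin_comb_in_subspace)
  then have W: "span ?S = subspace_sum U V"
    unfolding assms(14,15) krylov_space_def by (rule span_families_eq_krylov_sum[OF B ritz])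

  define a b where "a i = M *v uR i" and "b i = M *v vR i" for i
  define x y where "x = M *v u j" and "y = M *v v j"
  have MB: "b_inner B z z' = (M *v z) \<bullet> (M *v z')" for z z' by (rule b_inner_sqrt[OF M])
  have HM: "H *v (M *v z) = M *v (?C *v z)" for z
    unfolding assms(23) by (rule conjugated_pencil[OF B M])
  have surjM: "\<exists>z'. z = M *v z'" for z
    using M spd_matrix_inv_vector(1)[of M z] unfolding spd_sqrt_def by metis
  have skewH: "(H *v z) \<bullet> z' = - (z \<bullet> (H *v z'))" for z z'
  proof -
    obtain r r' where "z = M *v r" "z' = M *v r'" using surjM by metis
    then show ?thesis using skew_symmetric_b_inner[OF A B, of r r'] by (simp add: HM MB)
  qed
  have ab: "b_orthonormal_families (mat 1) m a b"
    using ritz unfolding b_orthonormal_families_def MB by (simp add: b_inner_def a_def b_def)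
  have image: "subspace_sum ((*v) M ` U) ((*v) M ` V) = (*v) M ` span ?S"
    unfolding W
  proof (intro set_eqI iffI)
    fix z assume "z \<in> subspace_sum ((*v) M ` U) ((*v) M ` V)"
    then obtain r s where "r \<in> U" "s \<in> V" "z = M *v (r + s)"
      by (auto simp: subspace_sum_def matrix_vector_right_distrib)
    then show "z \<in> (*v) M ` subspace_sum U V"
      unfolding subspace_sum_def by blast
  next
    fix z assume "z \<in> (*v) M ` subspace_sum U V"
    then obtain r s where "r \<in> U" "s \<in> V" "z = M *v r + M *v s"
      by (auto simp: subspace_sum_def matrix_vector_right_distrib)
    then show "z \<in> subspace_sum ((*v) M ` U) ((*v) M ` V)"
      unfolding subspace_sum_def by blast
  qed
  also have "\<dots> = span ((*v) M ` ?S)"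
    by (rule linear_span_image[symmetric]) simp
  also have "(*v) M ` ?S = a ` ?I \<union> b ` ?I"
    by (simp add: image_Un image_image a_def b_def)
  finally have P: "orthogonal_projector P (span (a ` ?I \<union> b ` ?I))"
    using assms(24) by simp
  have P_ab: "P *v a i = a i" "P *v b i = b i" if "i \<in> ?I" for i
    using that by (auto intro!: orthogonal_projector_fixes[OF P] span_base)
  have P_next: "P *v (M *v q (m + 1)) = 0"
  proof (rule orthogonal_projector_kills[OF P])
    fix s assume "s \<in> a ` ?I \<union> b ` ?I"
    then obtain k where k: "k \<in> ?I" "s = a k \<or> s = b k" by blast
    have "b_inner B (uR k) (q (m + 1)) = 0" "b_inner B (vR k) (q (m + 1)) = 0"
      using gsslbd_orthonormal(2,3)[OF A B assms(11) proc]
      by (simp_all add: uR[OF k(1)] vR[OF k(1)] lin_comb_def b_inner_simps)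
    then show "s \<bullet> (M *v q (m + 1)) = 0"
      using k(2) by (auto simp: MB a_def b_def)
  qed
  have PHa: "P *v (H *v a i) = - (\<theta> i *\<^sub>R b i)" and PHb: "P *v (H *v b i) = \<theta> i *\<^sub>R a i"
    if i: "i \<in> ?I" for i
  proof -
    note rel = gsslbd_ritz_relations[OF B proc G[rule_format, OF i]]
    have "1 \<le> m" using i by auto
    note rel = rel[OF this, folded uR[OF i] vR[OF i]]
    have "H *v a i = - (\<theta> i *\<^sub>R b i) - (\<beta> m * c i m) *\<^sub>R (M *v q (m + 1))"
      by (simp add: a_def b_def HM rel matrix_vector_mult_diff_distrib matrix_vector_mult_scaleR
          linear_neg[OF matrix_vector_mul_linear])
    then show "P *v (H *v a i) = - (\<theta> i *\<^sub>R b i)"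
      using P_next P_ab[OF i] by (simp add: matrix_vector_mult_diff_distrib
          matrix_vector_mult_scaleR linear_neg[OF matrix_vector_mul_linear])
    show "P *v (H *v b i) = \<theta> i *\<^sub>R a i"
      using P_ab[OF i]
      by (simp add: b_def HM rel matrix_vector_mult_scaleR flip: a_def)
  qed
  have Bcancel: "?C *v z = s *\<^sub>R z'" if "A *v z = s *\<^sub>R (B *v z')" for z z' s
    by (simp add: matrix_vector_mul_assoc[symmetric] that matrix_vector_mult_scaleR
        spd_matrix_inv_vector[OF B])
  have triplet: "A *v v j = \<sigma> j *\<^sub>R (B *v u j)" "A *v u j = (- \<sigma> j) *\<^sub>R (B *v v j)"
    using assms(8) jl by (auto simp: generalized_spectral_triplet_def)
  have Hxy: "H *v y = \<sigma> j *\<^sub>R x" "H *v x = - (\<sigma> j *\<^sub>R y)"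
    using Bcancel[OF triplet(1)] Bcancel[OF triplet(2)]
    by (simp_all add: x_def y_def HM matrix_vector_mult_scaleR linear_neg[OF matrix_vector_mul_linear])
  have unit: "x \<bullet> x = 1" "y \<bullet> y = 1"
    using uv jl unfolding b_orthonormal_families_def x_def y_def MB[symmetric] by metis+

  \<comment> \<open>The squared sine for the whole subspace is \<open>?T\<close>. Passing to the single pair \<open>j'\<close> adds the
     terms \<open>?f i\<close> of all other pairs, and these are what the perturbation estimate controls.\<close>
  let ?f = "\<lambda>i. (a i \<bullet> x)\<^sup>2 + (b i \<bullet> x)\<^sup>2 + (a i \<bullet> y)\<^sup>2 + (b i \<bullet> y)\<^sup>2"
  let ?T = "2 - (\<Sum>i\<in>?I. ?f i)"
  have sin: "sin_angle_F B (span (uR ` I \<union> vR ` I)) (span {u j, v j}) = sqrt (2 - (\<Sum>i\<in>I. ?f i))"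
    if "I \<subseteq> ?I" for I
    unfolding sin_angle_F_families[OF B M ritz that uv jl] MB
    by (simp add: a_def b_def x_def y_def sum.distrib)
  have sinW: "sin_angle_F B (subspace_sum U V) (span {u j, v j}) = sqrt ?T"
    using sin[of ?I] W by simp
  have "{uR j', vR j'} = uR ` {j'} \<union> vR ` {j'}" by auto
  then have sinX: "sin_angle_F B (span {uR j', vR j'}) (span {u j, v j}) = sqrt (?T + (\<Sum>i\<in>?J. ?f i))"
    using sin[of "{j'}"] j'm sum.remove[OF finite_atLeastAtMost j'm, of ?f]
    by (simp del: One_nat_def)
  have gap: "\<delta> * (\<Sum>i\<in>?J. ?f i) \<le> (norm2 ?E)\<^sup>2 * ?T"
    if "\<And>i. i \<in> ?J \<Longrightarrow> \<delta> \<le> (\<sigma> j - \<theta> i)\<^sup>2" for \<delta>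
  proof -
    have "\<delta> * (\<Sum>i\<in>?J. ?f i) \<le> (norm2 ?E)\<^sup>2 *
        ((x \<bullet> x - (\<Sum>i\<in>?I. (a i \<bullet> x)\<^sup>2 + (b i \<bullet> x)\<^sup>2))
          + (y \<bullet> y - (\<Sum>i\<in>?I. (a i \<bullet> y)\<^sup>2 + (b i \<bullet> y)\<^sup>2)))"
      using assms(5) jl G that
      by (intro compressed_skew_estimate[OF skewH P ab PHa PHb _ Hxy])
        (auto simp: singular_triplet_def less_imp_le)
    then show ?thesis by (simp add: unit sum.distrib algebra_simps)
  qed
  let ?Q = "quotient_by_min ((norm2 ?E)\<^sup>2) ?J (\<lambda>i. \<bar>\<sigma> j - \<theta> i\<bar>\<^sup>2)"
  have "(\<Sum>i\<in>?J. ?f i) \<le> ?Q * ?T"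
  proof (cases "?J = {}")
    case True
    then show ?thesis by (simp only: quotient_by_min_def) simp
  next
    case False
    define \<delta> where "\<delta> = Min ((\<lambda>i. \<bar>\<sigma> j - \<theta> i\<bar>\<^sup>2) ` ?J)"
    have le: "\<delta> \<le> (\<sigma> j - \<theta> i)\<^sup>2" if "i \<in> ?J" for i
      unfolding \<delta>_def using that by (intro Min_le) (auto intro!: image_eqI)
    \<comment> \<open>If \<open>\<sigma> j = \<theta> i\<close> for some \<open>i \<noteq> j'\<close>, then the closest Ritz value would equal \<open>\<theta> i\<close> as well.\<close>
    have pos: "0 < (\<sigma> j - \<theta> i)\<^sup>2" if "i \<in> ?J" for i
    proof -
      have "\<theta> i \<noteq> \<theta> j'" using inj\<theta> that j'm by (auto dest: inj_onD)
      moreover have "\<bar>\<sigma> j - \<theta> j'\<bar> \<le> \<bar>\<sigma> j - \<theta> i\<bar>" using assms(21) that by blast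
      ultimately show ?thesis by auto
    qed
    have "0 < \<delta>" unfolding \<delta>_def using False pos by (subst Min_gr_iff) auto
    then have "(\<Sum>i\<in>?J. ?f i) \<le> (norm2 ?E)\<^sup>2 * ?T / \<delta>"
      using gap[OF le] by (simp add: pos_le_divide_eq mult.commute)
    then show ?thesis using False by (simp add: quotient_by_min_def \<delta>_def)
  qed
  then have "?T + (\<Sum>i\<in>?J. ?f i) \<le> (1 + ?Q) * ?T"
    by (simp add: distrib_right)
  then show ?thesis
    unfolding sinX sinW real_sqrt_mult[symmetric] by (rule real_sqrt_le_mono)
qed

end
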